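(* Let $G=G_1\sqcup G_2$ be the disjoint union of two finite simple graphs $G_1$ and $G_2$. Then $\mathrm{v}(J_G)=\mathrm{v}(J_{G_1})+\mathrm{v}(J_{G_2})$.
   Context: Let $K$ be a field. For a finite simple graph $G$, the binomial edge ideal $J_G$ is the ideal of the standard graded polynomial ring $S=K[x_i,y_i\mid i\in V(G)]$ generated by $f_{ij}=x_iy_j-x_jy_i$ for all edges $\{i,j\}\in E(G)$ (with $V(G)$ totally ordered and $i<j$). For $G_1$ and $G_2$ the ideals $J_{G_1}$, $J_{G_2}$ are taken in the polynomial rings on the variables of their own vertex sets. For a proper graded ideal $I$ of a standard graded polynomial ring $R=\bigoplus_{d\ge 0}R_d$ over $K$, $\mathrm{Ass}(I)$ denotes the set of associated primes of $R/I$, and $\mathrm{v}(I)=\min\{d\ge 0\mid \exists f\in R_d \text{ and } \mathfrak p\in \mathrm{Ass}(I)\text{ with }(I:f)=\mathfrak p\}$. *)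

theory Defs
  imports "HOL-Library.Poly_Mapping" "HOL-Algebra.QuotRing"
begin

subsection \<open>Finite simple graphs\<close>

record 'v graph =
  verts :: "'v set"
  edges :: "'v set set"

definition finite_simple_graph :: "'v graph \<Rightarrow> bool" where
  "finite_simple_graph G \<longleftrightarrow>
     finite (verts G) \<and> (\<forall>e\<in>edges G. e \<subseteq> verts G \<and> card e = 2)"

text \<open>To be used for graphs whose vertex sets are disjoint.\<close>

definition graph_union :: "'v graph \<Rightarrow> 'v graph \<Rightarrow> 'v graph" where
  "graph_union G H = \<lparr>verts = verts G \<union> verts H, edges = edges G \<union> edges H\<rparr>"


subsection \<open>Polynomial rings\<close>

text \<open>
  A polynomial is a finitely supported map from monomials to coefficients, and a monomial is a
  finitely supported map from variables to exponents. The polynomial ring on a set of variables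
  \<open>X\<close> consists of the polynomials all of whose monomials involve variables from \<open>X\<close> only.
\<close>

type_synonym ('x, 'k) mpoly = "('x \<Rightarrow>\<^sub>0 nat) \<Rightarrow>\<^sub>0 'k"

definition poly_ring :: "'x set \<Rightarrow> ('x, 'k::field) mpoly ring" where
  "poly_ring X =
     \<lparr>carrier = {p. \<forall>m\<in>Poly_Mapping.keys p. Poly_Mapping.keys m \<subseteq> X},
      mult = (*), one = 1, zero = 0, add = (+)\<rparr>"

definition total_degree :: "('x \<Rightarrow>\<^sub>0 nat) \<Rightarrow> nat" where
  "total_degree m = (\<Sum>x\<in>Poly_Mapping.keys m. Poly_Mapping.lookup m x)"

text \<open>The graded components contain \<open>0\<close> in every degree.\<close>

definition homogeneous_part :: "'x set \<Rightarrow> nat \<Rightarrow> ('x, 'k::field) mpoly set" where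
  "homogeneous_part X d =
     {p \<in> carrier (poly_ring X). \<forall>m\<in>Poly_Mapping.keys p. total_degree m = d}"

definition indet :: "'x \<Rightarrow> ('x, 'k::field) mpoly" where
  "indet x = Poly_Mapping.single (Poly_Mapping.single x 1) 1"


subsection \<open>Associated primes and the v-number\<close>

text \<open>
  Annihilators are taken in the \<open>R\<close>-module \<open>R Quot I\<close>, on which \<open>r\<close> acts as multiplication by
  its class \<open>I +>\<^bsub>R\<^esub> r\<close>.
\<close>

definition Ass :: "('a, 'b) ring_scheme \<Rightarrow> 'a set \<Rightarrow> 'a set set" where
  "Ass R I =
     {P. primeideal P R \<and>
         (\<exists>m\<in>carrier (R Quot I).
            P = {r \<in> carrier R. (I +>\<^bsub>R\<^esub> r) \<otimes>\<^bsub>R Quot I\<^esub> m = \<zero>\<^bsub>R Quot I\<^esub>})}"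

definition colon :: "('a, 'b) ring_scheme \<Rightarrow> 'a set \<Rightarrow> 'a \<Rightarrow> 'a set" where
  "colon R I f = {g \<in> carrier R. g \<otimes>\<^bsub>R\<^esub> f \<in> I}"

text \<open>
  For a proper graded ideal \<open>I\<close> and finite \<open>X\<close>, the set of degrees is nonempty, so \<open>LEAST\<close> is a
  genuine minimum.
\<close>

definition v_number :: "'x set \<Rightarrow> ('x, 'k::field) mpoly set \<Rightarrow> nat" where
  "v_number X I =
     (LEAST d. \<exists>f\<in>homogeneous_part X d. \<exists>P\<in>Ass (poly_ring X) I. colon (poly_ring X) I f = P)"


subsection \<open>Binomial edge ideals\<close>

datatype 'v edge_var = XV 'v | YV 'v

definition edge_vars :: "'v graph \<Rightarrow> 'v edge_var set" where
  "edge_vars G = XV ` verts G \<union> YV ` verts G"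

definition edge_binomial :: "'v \<Rightarrow> 'v \<Rightarrow> ('v edge_var, 'k::field) mpoly" where
  "edge_binomial i j = indet (XV i) * indet (YV j) - indet (XV j) * indet (YV i)"

definition binomial_edge_ideal :: "'v::linorder graph \<Rightarrow> ('v edge_var, 'k::field) mpoly set" where
  "binomial_edge_ideal G =
     Idl\<^bsub>poly_ring (edge_vars G)\<^esub> {edge_binomial i j | i j. {i, j} \<in> edges G \<and> i < j}"

end

theory Submission
  imports Defs "HOL.Modules"
begin

text \<open>
  Two facts give the theorem: the primes that occur as colon ideals of a binomial edge ideal are
  toric, and toric ideals behave well when sets of variables are put side by side.

  Write \<open>f_ij = x_i y_j - x_j y_i\<close>. For a set \<open>T\<close> of killed vertices and a relation \<open>E\<close>, let
  \<open>J T E\<close> be generated by the variables at \<open>T\<close> and the \<open>f_ij\<close> with \<open>(i, j)\<close> in \<open>E\<close>. If \<open>i, v, j\<close> is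
  a path, then \<open>J T E\<close> is the intersection of the ideal where \<open>v\<close> is killed in addition and the ideal
  where the edge \<open>ij\<close> is added (\<open>J_split\<close>). Repeating this ends in a finite intersection of ideals
  of cluster graphs, that is, of disjoint unions of complete graphs on the vertices outside \<open>T\<close>
  (\<open>J_decomposition\<close>). The ideal of a cluster graph is the kernel of a monomial map into an integral
  domain over the same field, hence prime over every field (\<open>toric_kernel\<close>, \<open>J_cluster_prime\<close>).
  Consequently a colon ideal by \<open>f\<close> is prime if and only if it is \<open>J T E\<close> for a cluster graph such
  that \<open>f\<close> is not in \<open>J T E\<close> but multiplies \<open>J T E\<close> into the binomial edge ideal
  (\<open>colon_prime_iff_witness\<close>). Call such an \<open>f\<close> a witness. The v-number is the least degree of a
  homogeneous witness, and witnesses exist (\<open>witness_exists\<close>).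

  For a disjoint union, the product of a witness for one part and a witness for the other is a
  witness for the sum of the two primes: this sum belongs to a cluster graph again, so it is prime
  (\<open>witness_mult\<close>). Over a field that is not algebraically closed the sum of two arbitrary primes in
  disjoint variables may fail to be prime, so the explicit description of the primes matters here.

  Conversely let \<open>f\<close> be a witness of degree \<open>d\<close> for the union. A slice of \<open>f\<close> collects the terms
  whose part on the second vertex set has a given image under the monomial map, and keeps their
  parts on the first one. Slices are linear over the first polynomial ring and map the binomial edge
  ideal of the union to that of the first graph, so a slice outside the prime is a witness for the
  first graph. Its degree is \<open>d\<close> minus the degree of the part forgotten. Slicing in both ways at one
  and the same monomial gives two witnesses whose degrees add up to \<open>d\<close> (\<open>witness_split\<close>). So the
  degrees of witnesses for the union are the sums of degrees of witnesses for the parts.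
\<close>

section \<open>Additive extension along finitely supported maps\<close>

definition coeff_additive :: "('a \<Rightarrow> 'b::comm_monoid_add \<Rightarrow> 'c::comm_monoid_add) \<Rightarrow> bool" where
  "coeff_additive h \<longleftrightarrow> (\<forall>k. h k 0 = 0) \<and> (\<forall>k a b. h k (a + b) = h k a + h k b)"

text \<open>
  The additive maps of the proof (ring homomorphisms that send monomials to monomials or to \<open>0\<close>,
  coefficient extraction, degrees of monomials) are prescribed on maps with a single key. All of
  them are instances of one extension, and identities between them need checking there only.
\<close>

definition extend :: "('a \<Rightarrow> 'b::comm_monoid_add \<Rightarrow> 'c::comm_monoid_add) \<Rightarrow> ('a \<Rightarrow>\<^sub>0 'b) \<Rightarrow> 'c" where
  "extend h p = (\<Sum>k\<in>Poly_Mapping.keys p. h k (Poly_Mapping.lookup p k))"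

lemma extend_zero [simp]: "extend h 0 = 0"
  by (simp add: extend_def)

lemma extend_add: "coeff_additive h \<Longrightarrow> extend h (p + q) = extend h p + extend h q"
  unfolding extend_def coeff_additive_def by (intro setsum_keys_plus_distrib) auto

lemma extend_single: "coeff_additive h \<Longrightarrow> extend h (Poly_Mapping.single k a) = h k a"
  unfolding extend_def coeff_additive_def by (cases "a = 0") auto

lemma extend_diff:
  fixes h :: "'a \<Rightarrow> 'b::ab_group_add \<Rightarrow> 'c::ab_group_add"
  assumes "coeff_additive h"
  shows "extend h (p - q) = extend h p - extend h q"
  using extend_add[OF assms, of "p - q" q] by simp

lemma poly_mapping_add_induct [case_names zero single add]:
  fixes f :: "'a \<Rightarrow>\<^sub>0 'b::comm_monoid_add"
  assumes "P 0"
    and "\<And>k a. k \<in> Poly_Mapping.keys f \<Longrightarrow> P (Poly_Mapping.single k a)"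
    and "\<And>p q. P p \<Longrightarrow> P q \<Longrightarrow> P (p + q)"
  shows "P f"
proof -
  have "P (\<Sum>k\<in>A. Poly_Mapping.single k (Poly_Mapping.lookup f k))"
    if "finite A" "A \<subseteq> Poly_Mapping.keys f" for A
    using that by (induction A rule: finite_induct) (auto intro: assms)
  moreover have "f = (\<Sum>k\<in>Poly_Mapping.keys f. Poly_Mapping.single k (Poly_Mapping.lookup f k))"
    by (rule poly_mapping_eqI) (auto simp: lookup_sum lookup_single when_def in_keys_iff)
  ultimately show ?thesis
    by (metis finite_keys order_refl)
qed

lemma extend_mult:
  fixes h :: "'a::comm_monoid_add \<Rightarrow> 'b::comm_ring_1 \<Rightarrow> 'c::comm_ring_1"
  assumes h: "coeff_additive h" and mult: "\<And>k l a b. h (k + l) (a * b) = h k a * h l b"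
  shows "extend h (p * q) = extend h p * extend h q"
proof (induction p rule: poly_mapping_add_induct)
  case (single k a)
  show ?case
  proof (induction q rule: poly_mapping_add_induct)
    case (single l b)
    show ?case by (simp add: mult_single extend_single h mult)
  qed (simp_all add: distrib_left extend_add h)
qed (simp_all add: distrib_right extend_add h)

lemma keys_extend_subset:
  "Poly_Mapping.keys (extend h p)
     \<subseteq> (\<Union>k\<in>Poly_Mapping.keys p. Poly_Mapping.keys (h k (Poly_Mapping.lookup p k)))"
  unfolding extend_def by (rule keys_sum)

lemma keys_add_nat:
  fixes m n :: "'a \<Rightarrow>\<^sub>0 nat"
  shows "Poly_Mapping.keys (m + n) = Poly_Mapping.keys m \<union> Poly_Mapping.keys n"
  by (auto simp: in_keys_iff lookup_add)


section \<open>Binomial edge ideals with killed vertices\<close>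

text \<open>
  The ideal generated by a set is its span over the ring itself. Ideals live in the polynomial ring
  on all variables; intersecting with the polynomials in fewer variables recovers the ideals of the
  smaller rings that have the same generators, so no extension of ideals along inclusions of rings
  is involved.
\<close>

interpretation gen: Modules.module "(*) :: 'a::comm_ring_1 \<Rightarrow> 'a \<Rightarrow> 'a"
  by unfold_locales (simp_all add: algebra_simps)

(* As a rewrite rule this is associativity, oriented against mult.assoc: the two loop together. *)
declare gen.scale_scale [simp del]

primrec vert :: "'v edge_var \<Rightarrow> 'v" where
  "vert (XV i) = i"
| "vert (YV i) = i"

lemma edge_vars_eq: "edge_vars G = vert -` verts G"
proof -
  have "z \<in> edge_vars G \<longleftrightarrow> vert z \<in> verts G" for z
    by (cases z) (auto simp: edge_vars_def)
  then show ?thesis by auto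
qed

definition gens :: "'v set \<Rightarrow> ('v \<times> 'v) set \<Rightarrow> ('v edge_var, 'k::field) mpoly set" where
  "gens T E = {indet z | z. vert z \<in> T} \<union> {edge_binomial i j | i j. (i, j) \<in> E}"

text \<open>
  \<open>J T E\<close> is generated by both variables at every vertex of \<open>T\<close> and the binomials of the pairs
  in \<open>E\<close>. Relations replace edge sets because the splitting below adds pairs along paths; the
  binomial of \<open>(j, i)\<close> is the negative of that of \<open>(i, j)\<close>. The binomial edge ideal is the case
  \<open>T = {}\<close>, and the minimal primes are of the form \<open>J T E\<close> as well.
\<close>

definition J :: "'v set \<Rightarrow> ('v \<times> 'v) set \<Rightarrow> ('v edge_var, 'k::field) mpoly set" where
  "J T E = gen.span (gens T E)"

lemma edge_binomial_swap: "edge_binomial j i = - edge_binomial i j"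
  by (simp add: edge_binomial_def)

lemma edge_binomial_self [simp]: "edge_binomial i i = 0"
  by (simp add: edge_binomial_def)

lemma J_add: "p \<in> J T E \<Longrightarrow> q \<in> J T E \<Longrightarrow> p + q \<in> J T E"
  unfolding J_def by (rule gen.span_add)

lemma J_diff: "p \<in> J T E \<Longrightarrow> q \<in> J T E \<Longrightarrow> p - q \<in> J T E"
  unfolding J_def by (rule gen.span_diff)

lemma J_mult: "p \<in> J T E \<Longrightarrow> r * p \<in> J T E"
  unfolding J_def by (rule gen.span_scale)

lemma J_mult_right: "p \<in> J T E \<Longrightarrow> p * r \<in> J T E"
  using J_mult[of p T E r] by (simp add: mult.commute)

lemma J_zero [simp]: "0 \<in> J T E"
  unfolding J_def by (rule gen.span_zero)

lemma J_var: "vert z \<in> T \<Longrightarrow> indet z \<in> J T E"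
  unfolding J_def gens_def by (rule gen.span_base) auto

lemma J_edge: "(i, j) \<in> E \<Longrightarrow> edge_binomial i j \<in> J T E"
  unfolding J_def gens_def by (rule gen.span_base) auto

lemma J_least: "gens T E \<subseteq> (J T' E' :: ('v edge_var, 'k::field) mpoly set)
    \<Longrightarrow> J T E \<subseteq> (J T' E' :: ('v edge_var, 'k) mpoly set)"
  unfolding J_def by (erule gen.span_minimal) (rule gen.subspace_span)

lemma gens_mono: "g \<in> gens T E \<Longrightarrow> T \<subseteq> T' \<Longrightarrow> E \<subseteq> E' \<Longrightarrow> g \<in> gens T' E'"
  unfolding gens_def by blast

lemma J_mono: "p \<in> J T E \<Longrightarrow> T \<subseteq> T' \<Longrightarrow> E \<subseteq> E' \<Longrightarrow> p \<in> J T' E'"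
  unfolding J_def by (erule rev_subsetD, rule gen.span_mono) (blast intro: gens_mono)

lemma J_induct [consumes 1, case_names zero step]:
  assumes "p \<in> J T E" and "P 0"
    and "\<And>r g q. g \<in> gens T E \<Longrightarrow> P q \<Longrightarrow> P (r * g + q)"
  shows "P p"
  using assms(1) unfolding J_def
  by (induction rule: gen.span_induct_alt) (auto intro: assms(2,3))

subsection \<open>Retraction onto a set of vertices\<close>

text \<open>
  Setting the variables at all vertices outside \<open>A\<close> to \<open>0\<close>.
\<close>

definition retract :: "'v set \<Rightarrow> ('v edge_var, 'k::field) mpoly \<Rightarrow> ('v edge_var, 'k) mpoly" where
  "retract A =
     extend (\<lambda>m a. if Poly_Mapping.keys m \<subseteq> vert -` A then Poly_Mapping.single m a else 0)"

lemma retract_additive: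
  "coeff_additive (\<lambda>m a. if Poly_Mapping.keys m \<subseteq> vert -` A then Poly_Mapping.single m a else 0)"
  by (auto simp: coeff_additive_def single_add)

lemma retract_add: "retract A (p + q) = retract A p + retract A q"
  unfolding retract_def by (rule extend_add[OF retract_additive])

lemma retract_zero [simp]: "retract A 0 = 0"
  by (simp add: retract_def)

lemma retract_diff: "retract A (p - q) = retract A p - retract A q"
  unfolding retract_def by (rule extend_diff[OF retract_additive])

lemma retract_mult: "retract A (p * q) = retract A p * retract A q"
  unfolding retract_def by (rule extend_mult[OF retract_additive]) (auto simp: keys_add_nat mult_single)

lemma retract_single:
  "retract A (Poly_Mapping.single m a)
     = (if Poly_Mapping.keys m \<subseteq> vert -` A then Poly_Mapping.single m a else 0)"
  unfolding retract_def by (rule extend_single[OF retract_additive])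

lemma retract_indet: "retract A (indet z) = (if vert z \<in> A then indet z else 0)"
  by (simp add: indet_def retract_single)

lemma retract_edge_binomial:
  "retract A (edge_binomial i j) = (if i \<in> A \<and> j \<in> A then edge_binomial i j else 0)"
  by (simp add: edge_binomial_def retract_diff retract_mult retract_indet)

abbreviation pcarrier :: "'v set \<Rightarrow> ('v edge_var, 'k::field) mpoly set" where
  "pcarrier A \<equiv> carrier (poly_ring (vert -` A))"

lemma pcarrier_iff:
  "p \<in> pcarrier A \<longleftrightarrow> (\<forall>m\<in>Poly_Mapping.keys p. Poly_Mapping.keys m \<subseteq> vert -` A)"
  by (simp add: poly_ring_def)

lemma retract_fixed: "p \<in> pcarrier A \<Longrightarrow> retract A p = p"
  unfolding pcarrier_iff
proof -
  assume p: "\<forall>m\<in>Poly_Mapping.keys p. Poly_Mapping.keys m \<subseteq> vert -` A"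
  have "retract A p = (\<Sum>k\<in>Poly_Mapping.keys p. Poly_Mapping.single k (Poly_Mapping.lookup p k))"
    unfolding retract_def extend_def using p by (intro sum.cong) auto
  also have "\<dots> = p"
    by (rule poly_mapping_eqI) (auto simp: lookup_sum lookup_single when_def in_keys_iff)
  finally show ?thesis .
qed

lemma retract_in: "retract A p \<in> pcarrier A"
  unfolding pcarrier_iff retract_def
  using keys_extend_subset[of "\<lambda>m a. if Poly_Mapping.keys m \<subseteq> vert -` A then Poly_Mapping.single m a else 0" p]
  by (fastforce split: if_splits)

lemma retract_J: "p \<in> J T E \<Longrightarrow> retract A p \<in> J (T \<inter> A) (E \<inter> A \<times> A)"
proof (induction rule: J_induct)
  case (step r g q)
  have "retract A g \<in> J (T \<inter> A) (E \<inter> A \<times> A)"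
    using step.hyps unfolding gens_def
    by (auto simp: retract_indet retract_edge_binomial intro: J_var J_edge)
  then show ?case
    using step.IH by (simp add: retract_add retract_mult J_add J_mult)
qed simp

lemma monomial_factor:
  assumes "z \<in> Poly_Mapping.keys m"
  obtains n :: "'x \<Rightarrow>\<^sub>0 nat" where "m = n + Poly_Mapping.single z 1"
proof
  show "m = (m - Poly_Mapping.single z 1) + Poly_Mapping.single z 1"
    by (rule poly_mapping_eqI)
      (use assms in \<open>auto simp: lookup_add lookup_minus lookup_single when_def in_keys_iff\<close>)
qed

lemma single_add_indet: "Poly_Mapping.single (n + Poly_Mapping.single z 1) a = Poly_Mapping.single n a * indet z"
  by (simp add: indet_def mult_single)

text \<open>
  Every monomial of \<open>c - retract A c\<close> contains a variable at a vertex outside \<open>A\<close>.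
\<close>

lemma mult_diff_retract:
  assumes "\<And>z. vert z \<notin> A \<Longrightarrow> indet z * g \<in> J T E"
  shows "(c - retract A c) * g \<in> J T E"
proof (induction c rule: poly_mapping_add_induct)
  case zero
  show ?case by simp
next
  case (single m a)
  show ?case
  proof (cases "Poly_Mapping.keys m \<subseteq> vert -` A")
    case True
    then show ?thesis by (simp add: retract_single)
  next
    case False
    then obtain z where z: "z \<in> Poly_Mapping.keys m" "vert z \<notin> A" by auto
    from z(1) obtain n where n: "m = n + Poly_Mapping.single z 1" by (rule monomial_factor)
    have "Poly_Mapping.single m a * g \<in> J T E"
      using J_mult[OF assms[OF z(2)]] unfolding n single_add_indet mult.assoc .
    then show ?thesis
      using False by (simp add: retract_single)
  qed
next
  case (add p q)
  then show ?case using J_add[OF add] by (simp add: retract_add algebra_simps)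
qed

subsection \<open>Splitting\<close>

text \<open>
  The Pluecker relations \<open>x_v f_ij = x_i f_vj + x_j f_iv\<close> and \<open>y_v f_ij = y_i f_vj + y_j f_iv\<close>.
\<close>

lemma indet_mult_edge_binomial:
  assumes "(i, v) \<in> E" "(v, j) \<in> E" "vert z = v"
  shows "indet z * edge_binomial i j \<in> (J T E :: ('v edge_var, 'k::field) mpoly set)"
    (is "indet z * ?f i j \<in> _")
proof (cases z)
  case (XV w)
  have "indet z * ?f i j = indet (XV i) * ?f v j + indet (XV j) * ?f i v"
    using XV assms(3) by (simp add: edge_binomial_def algebra_simps)
  then show ?thesis using assms by (simp add: J_add J_mult J_edge)
next
  case (YV w)
  have "indet z * ?f i j = indet (YV i) * ?f v j + indet (YV j) * ?f i v"
    using YV assms(3) by (simp add: edge_binomial_def algebra_simps)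
  then show ?thesis using assms by (simp add: J_add J_mult J_edge)
qed

lemma J_insert_edge:
  assumes "p \<in> J T (E \<union> {(i, j), (j, i)})"
  shows "\<exists>c. p - c * edge_binomial i j \<in> J T E"
  using assms
proof (induction rule: J_induct)
  case zero
  show ?case by (rule exI[of _ 0]) simp
next
  case (step r g q)
  from step.IH obtain c where c: "q - c * edge_binomial i j \<in> J T E" ..
  obtain d where d: "g - d * edge_binomial i j \<in> J T E"
  proof -
    consider "g \<in> J T E" | "g = edge_binomial i j" | "g = - edge_binomial i j"
      using step.hyps unfolding gens_def
      by (auto intro: J_var J_edge simp: edge_binomial_swap[of j i])
    then show ?thesis
    proof cases
      case 1
      then show ?thesis by (intro that[of 0]) simp
    next
      case 2
      then show ?thesis by (intro that[of 1]) simp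
    next
      case 3
      then show ?thesis by (intro that[of "- 1"]) simp
    qed
  qed
  have eq: "r * g + q - (r * d + c) * edge_binomial i j
      = r * (g - d * edge_binomial i j) + (q - c * edge_binomial i j)"
    by (simp add: algebra_simps)
  show ?case
    by (rule exI[of _ "r * d + c"], unfold eq) (intro J_add J_mult d c)
qed

text \<open>
  An edge can be added along the path \<open>i, v, j\<close> at the price of a component in which \<open>v\<close> is killed.
  An element of the right-hand side is \<open>c f_ij\<close> modulo \<open>J T E\<close>. The variables at \<open>v\<close> multiply
  \<open>f_ij\<close> into \<open>J T E\<close>, so \<open>c\<close> may be replaced by its retraction \<open>c'\<close> that is free of \<open>v\<close>. As
  \<open>c f_ij\<close> lies in the ideal with \<open>v\<close> killed, setting the variables at \<open>v\<close> to \<open>0\<close> puts \<open>c' f_ij\<close>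
  into \<open>J T E\<close>.
\<close>

lemma J_split:
  fixes T :: "'v set"
  assumes iv: "(i, v) \<in> E" and vj: "(v, j) \<in> E" and "i \<noteq> v" "j \<noteq> v"
  shows "(J T E :: ('v edge_var, 'k::field) mpoly set)
           = J (insert v T) E \<inter> J T (E \<union> {(i, j), (j, i)})" (is "?I = ?J1 \<inter> ?J2")
proof
  show "?I \<subseteq> ?J1 \<inter> ?J2" by (auto elim: J_mono)
next
  show "?J1 \<inter> ?J2 \<subseteq> ?I"
  proof
    fix g assume g: "g \<in> ?J1 \<inter> ?J2"
    then obtain c where c: "g - c * edge_binomial i j \<in> ?I"
      using J_insert_edge[of g T E i j] by blast
    then have "g - c * edge_binomial i j \<in> ?J1"
      by (rule J_mono) auto
    then have "c * edge_binomial i j \<in> J (insert v T) E"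
      using J_diff[of g "insert v T" E "g - c * edge_binomial i j"] g by simp
    from retract_J[OF this, of "- {v}"]
    have "retract (- {v}) c * edge_binomial i j \<in> J (insert v T \<inter> - {v}) (E \<inter> (- {v}) \<times> (- {v}))"
      using assms by (simp add: retract_mult retract_edge_binomial)
    then have 1: "retract (- {v}) c * edge_binomial i j \<in> ?I"
      by (rule J_mono) auto
    have 2: "(c - retract (- {v}) c) * edge_binomial i j \<in> J T E"
      by (rule mult_diff_retract) (use indet_mult_edge_binomial[OF iv vj] in auto)
    have eq: "g = (g - c * edge_binomial i j)
              + (retract (- {v}) c * edge_binomial i j + (c - retract (- {v}) c) * edge_binomial i j)"
      by (simp add: algebra_simps)
    show "g \<in> J T E" by (subst eq) (intro J_add c 1 2)
  qed
qed


section \<open>Degrees of monomials\<close>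

text \<open>
  The toric map defined below substitutes \<open>x_i = u_i\<close> and \<open>y_i = u_i t_(c i)\<close>, where \<open>c i\<close> stands
  for the connected component of \<open>i\<close>. The image of a monomial has the exponent vector \<open>multideg m\<close>
  in the variables \<open>u\<close> and \<open>ydeg c m\<close> in the variables \<open>t\<close>.
\<close>

definition multideg :: "('v edge_var \<Rightarrow>\<^sub>0 nat) \<Rightarrow> ('v \<Rightarrow>\<^sub>0 nat)" where
  "multideg = extend (\<lambda>z n. Poly_Mapping.single (vert z) n)"

definition ydeg :: "('v \<Rightarrow> 'v) \<Rightarrow> ('v edge_var \<Rightarrow>\<^sub>0 nat) \<Rightarrow> ('v \<Rightarrow>\<^sub>0 nat)" where
  "ydeg c = extend (\<lambda>z n. case z of XV i \<Rightarrow> 0 | YV i \<Rightarrow> Poly_Mapping.single (c i) n)"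

lemma multideg_additive: "coeff_additive (\<lambda>z (n::nat). Poly_Mapping.single (vert z) n)"
  by (simp add: coeff_additive_def single_add)

lemma ydeg_additive:
  "coeff_additive (\<lambda>z (n::nat). case z of XV i \<Rightarrow> 0 | YV i \<Rightarrow> Poly_Mapping.single (c i) n)"
  by (auto simp: coeff_additive_def single_add split: edge_var.split)

lemma multideg_zero [simp]: "multideg 0 = 0" by (simp add: multideg_def)
lemma ydeg_zero [simp]: "ydeg c 0 = 0" by (simp add: ydeg_def)

lemma multideg_add: "multideg (m + n) = multideg m + multideg n"
  unfolding multideg_def by (rule extend_add[OF multideg_additive])

lemma ydeg_add: "ydeg c (m + n) = ydeg c m + ydeg c n"
  unfolding ydeg_def by (rule extend_add[OF ydeg_additive])

lemma multideg_single [simp]: "multideg (Poly_Mapping.single z n) = Poly_Mapping.single (vert z) n"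
  unfolding multideg_def by (rule extend_single[OF multideg_additive])

lemma ydeg_single_XV [simp]: "ydeg c (Poly_Mapping.single (XV i) n) = 0"
  unfolding ydeg_def by (simp add: extend_single[OF ydeg_additive])

lemma ydeg_single_YV [simp]: "ydeg c (Poly_Mapping.single (YV i) n) = Poly_Mapping.single (c i) n"
  unfolding ydeg_def by (simp add: extend_single[OF ydeg_additive])

lemma lookup_multideg:
  "Poly_Mapping.lookup (multideg m) i = Poly_Mapping.lookup m (XV i) + Poly_Mapping.lookup m (YV i)"
proof (induction m rule: poly_mapping_add_induct)
  case (single z n)
  then show ?case by (cases z) (auto simp: lookup_single when_def)
qed (simp_all add: multideg_add lookup_add)

lemma keys_multideg: "Poly_Mapping.keys (multideg m) = vert ` Poly_Mapping.keys m"
proof -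
  have "i \<in> Poly_Mapping.keys (multideg m) \<longleftrightarrow> XV i \<in> Poly_Mapping.keys m \<or> YV i \<in> Poly_Mapping.keys m" for i
    by (simp add: in_keys_iff lookup_multideg)
  moreover have "i = vert z \<longleftrightarrow> z = XV i \<or> z = YV i" for i :: 'a and z
    by (cases z) auto
  then have "i \<in> vert ` Poly_Mapping.keys m \<longleftrightarrow> XV i \<in> Poly_Mapping.keys m \<or> YV i \<in> Poly_Mapping.keys m" for i
    by (simp add: image_iff) blast
  ultimately show ?thesis by blast
qed

lemma keys_ydegI:
  assumes "YV j \<in> Poly_Mapping.keys m"
  shows "c j \<in> Poly_Mapping.keys (ydeg c m)"
proof -
  from assms obtain n where "m = n + Poly_Mapping.single (YV j) 1" by (rule monomial_factor)
  then show ?thesis by (simp add: ydeg_add in_keys_iff lookup_add)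
qed

lemma keys_ydegE:
  assumes "k \<in> Poly_Mapping.keys (ydeg c m)"
  obtains j where "YV j \<in> Poly_Mapping.keys m" "c j = k"
proof -
  obtain z where "z \<in> Poly_Mapping.keys m"
    "k \<in> Poly_Mapping.keys (case z of XV i \<Rightarrow> 0 | YV i \<Rightarrow> Poly_Mapping.single (c i) (Poly_Mapping.lookup m z))"
    using assms keys_extend_subset unfolding ydeg_def by fast
  then show ?thesis using that by (cases z) (auto split: if_splits)
qed

lemma total_degree_eq_extend: "total_degree m = extend (\<lambda>z n. n) m"
  by (simp add: total_degree_def extend_def)

lemma total_degree_add: "total_degree (m + n) = total_degree m + total_degree n"
  unfolding total_degree_eq_extend by (rule extend_add) (simp add: coeff_additive_def)

lemma total_degree_single [simp]: "total_degree (Poly_Mapping.single z n) = n"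
  unfolding total_degree_eq_extend by (rule extend_single) (simp add: coeff_additive_def)

lemma total_degree_zero [simp]: "total_degree 0 = 0"
  by (simp add: total_degree_def)

lemma total_degree_multideg: "total_degree (multideg m) = total_degree m"
  by (induction m rule: poly_mapping_add_induct) (simp_all add: multideg_add total_degree_add)


section \<open>The toric map of a cluster graph\<close>

text \<open>
  Outside \<open>T\<close> the relation is, up to the diagonal, an equivalence: the graph without the killed
  vertices is a disjoint union of complete graphs.
\<close>

definition cluster :: "'v set \<Rightarrow> ('v \<times> 'v) set \<Rightarrow> bool" where
  "cluster T E \<longleftrightarrow>
     sym E \<and> (\<forall>i v j. (i, v) \<in> E \<and> (v, j) \<in> E \<and> v \<notin> T \<longrightarrow> i = j \<or> (i, j) \<in> E)"

text \<open>
  Classes are named by representatives. That \<open>c i\<close> is \<open>i\<close> or related to \<open>i\<close> guarantees that \<open>c\<close>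
  does not leave a set of vertices from which no pair of \<open>E\<close> leads out.
\<close>

definition class_map :: "'v set \<Rightarrow> ('v \<times> 'v) set \<Rightarrow> ('v \<Rightarrow> 'v) \<Rightarrow> bool" where
  "class_map T E c \<longleftrightarrow>
     (\<forall>i j. i \<notin> T \<longrightarrow> j \<notin> T \<longrightarrow> (c i = c j \<longleftrightarrow> i = j \<or> (i, j) \<in> E)) \<and>
     (\<forall>i. c i = i \<or> (i, c i) \<in> E)"

lemma cluster_class_map:
  assumes "cluster T E"
  shows "\<exists>c. class_map T E c"
proof -
  define R where "R i = {j. j \<notin> T \<and> (i = j \<or> (i, j) \<in> E)}" for i
  \<comment> \<open>Related vertices have the same set \<open>R\<close>, so the choice depends on the class only.\<close>
  define c where "c i = (if i \<in> T then i else SOME j. j \<in> R i)" for i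
  have sym: "(i, j) \<in> E \<Longrightarrow> (j, i) \<in> E" for i j
    using assms by (auto simp: cluster_def sym_def)
  have trans: "(i, v) \<in> E \<Longrightarrow> (v, j) \<in> E \<Longrightarrow> v \<notin> T \<Longrightarrow> i = j \<or> (i, j) \<in> E" for i v j
    using assms by (auto simp: cluster_def)
  have c_in: "c i \<in> R i" if "i \<notin> T" for i
    unfolding c_def using that someI[of "\<lambda>j. j \<in> R i" i] by (auto simp: R_def)
  have "c i = c j \<longleftrightarrow> i = j \<or> (i, j) \<in> E" if "i \<notin> T" "j \<notin> T" for i j
  proof
    assume "c i = c j"
    then have k: "c j \<notin> T" "i = c j \<or> (i, c j) \<in> E" "c j = j \<or> (c j, j) \<in> E"
      using c_in[OF that(1)] c_in[OF that(2)] sym by (auto simp: R_def)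
    then show "i = j \<or> (i, j) \<in> E"
      using trans[of i "c j" j] by auto
  next
    assume *: "i = j \<or> (i, j) \<in> E"
    have "R i = R j" unfolding R_def using * that sym trans by blast
    then show "c i = c j" using that by (simp add: c_def)
  qed
  moreover have "c i = i \<or> (i, c i) \<in> E" for i
    using c_in[of i] by (cases "i \<in> T") (auto simp: c_def R_def)
  ultimately show ?thesis unfolding class_map_def by blast
qed

text \<open>
  The target is a polynomial ring in the \<open>u_i\<close> whose coefficients are polynomials in the \<open>t_k\<close>.
  It is an integral domain for every coefficient field, finite or not, which makes the kernel prime.
\<close>

definition toric :: "'v set \<Rightarrow> ('v \<Rightarrow> 'v) \<Rightarrow> ('v edge_var, 'k::field) mpoly
    \<Rightarrow> ('v \<Rightarrow>\<^sub>0 nat) \<Rightarrow>\<^sub>0 ('v \<Rightarrow>\<^sub>0 nat) \<Rightarrow>\<^sub>0 'k" where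
  "toric T c = extend (\<lambda>m a. if Poly_Mapping.keys (multideg m) \<inter> T = {}
     then Poly_Mapping.single (multideg m) (Poly_Mapping.single (ydeg c m) a) else 0)"

lemma toric_additive:
  "coeff_additive (\<lambda>m a. if Poly_Mapping.keys (multideg m) \<inter> T = {}
     then Poly_Mapping.single (multideg m) (Poly_Mapping.single (ydeg c m) a) else 0)"
  by (auto simp: coeff_additive_def single_add)

lemma toric_zero [simp]: "toric T c 0 = 0"
  by (simp add: toric_def)

lemma toric_add: "toric T c (p + q) = toric T c p + toric T c q"
  unfolding toric_def by (rule extend_add[OF toric_additive])

lemma toric_diff: "toric T c (p - q) = toric T c p - toric T c q"
  unfolding toric_def by (rule extend_diff[OF toric_additive])

lemma toric_mult: "toric T c (p * q) = toric T c p * toric T c q"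
  unfolding toric_def
  by (rule extend_mult[OF toric_additive])
    (auto simp: multideg_add ydeg_add keys_add_nat mult_single)

lemma toric_single:
  "toric T c (Poly_Mapping.single m a) = (if Poly_Mapping.keys (multideg m) \<inter> T = {}
     then Poly_Mapping.single (multideg m) (Poly_Mapping.single (ydeg c m) a) else 0)"
  unfolding toric_def by (rule extend_single[OF toric_additive])

lemma toric_indet_killed: "vert z \<in> T \<Longrightarrow> toric T c (indet z) = 0"
  by (simp add: indet_def toric_single)

lemma toric_edge_binomial:
  assumes "class_map T E c" "(i, j) \<in> E"
  shows "toric T c (edge_binomial i j) = 0"
proof (cases "i \<in> T \<or> j \<in> T")
  case True
  then show ?thesis
    by (auto simp: edge_binomial_def toric_diff toric_mult toric_indet_killed)
next
  case False
  then have "c i = c j" using assms unfolding class_map_def by blast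
  with False show ?thesis
    by (simp add: edge_binomial_def toric_diff toric_mult indet_def toric_single
        mult_single multideg_add ydeg_add keys_add_nat add.commute)
qed

lemma toric_J:
  assumes "class_map T E c" "p \<in> J T E"
  shows "toric T c p = 0"
  using assms(2)
proof (induction rule: J_induct)
  case (step r g q)
  then have "toric T c g = 0"
    using toric_edge_binomial[OF assms(1)] unfolding gens_def by (auto simp: toric_indet_killed)
  then show ?case using step.IH by (simp add: toric_add toric_mult)
qed simp

lemma single_killed_in_J:
  assumes "Poly_Mapping.keys (multideg m) \<inter> T \<noteq> {}"
  shows "Poly_Mapping.single m a \<in> J T E"
proof -
  from assms obtain z where z: "z \<in> Poly_Mapping.keys m" "vert z \<in> T"
    by (auto simp: keys_multideg)
  from z(1) obtain n where n: "m = n + Poly_Mapping.single z 1" by (rule monomial_factor)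
  show ?thesis unfolding n single_add_indet by (rule J_mult[OF J_var[OF z(2)]])
qed

text \<open>
  Two monomials with the same image under the toric map are congruent. A common variable can be
  cancelled. Otherwise some vertex \<open>i\<close> contributes \<open>x_i\<close> to one monomial and \<open>y_i\<close> to the other; as
  the exponents of \<open>t_(c i)\<close> agree, the first one contains some \<open>y_j\<close> with \<open>j\<close> in the class of \<open>i\<close>,
  and replacing \<open>x_i y_j\<close> by \<open>x_j y_i\<close> changes it by a multiple of \<open>f_ij\<close> and creates the common
  variable \<open>y_i\<close>.
\<close>

lemma single_diff_in_J:
  fixes a :: "'k::field"
  assumes c: "class_map T E c"
    and "Poly_Mapping.keys (multideg m) \<inter> T = {}"
    and "multideg m = multideg n" and "ydeg c m = ydeg c n"
  shows "Poly_Mapping.single m a - Poly_Mapping.single n a \<in> J T E"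
  using assms(2-)
proof (induction "total_degree m" arbitrary: m n rule: less_induct)
  case (less m n)
  let ?s = "\<lambda>m. Poly_Mapping.single m a"
  have common: "?s m' - ?s n' \<in> J T E"
    if z: "z \<in> Poly_Mapping.keys m'" "z \<in> Poly_Mapping.keys n'"
      and deg: "multideg m' = multideg m" "multideg n' = multideg m" "ydeg c m' = ydeg c n'"
    for m' n' z
  proof -
    obtain m1 where m1: "m' = m1 + Poly_Mapping.single z 1" using z(1) by (rule monomial_factor)
    obtain n1 where n1: "n' = n1 + Poly_Mapping.single z 1" using z(2) by (rule monomial_factor)
    have "total_degree m = total_degree m'"
      using deg(1) total_degree_multideg[of m] total_degree_multideg[of m'] by simp
    then have "total_degree m = total_degree m1 + 1"
      by (simp add: m1 total_degree_add)
    moreover have "multideg m' = multideg n'" using deg by simp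
    then have "multideg m1 = multideg n1" by (simp add: m1 n1 multideg_add)
    moreover have "ydeg c m1 = ydeg c n1"
      using deg(3) by (simp add: m1 n1 ydeg_add)
    moreover have "Poly_Mapping.keys (multideg m1) \<inter> T = {}"
      using less.prems(1) unfolding deg(1)[symmetric] m1 multideg_add keys_add_nat by blast
    ultimately have "?s m1 - ?s n1 \<in> J T E"
      by (intro less.hyps) auto
    from J_mult_right[OF this, of "indet z"] show ?thesis
      unfolding m1 n1 single_add_indet by (simp add: algebra_simps)
  qed
  have swap: "?s m' - ?s n' \<in> J T E"
    if z: "XV i \<in> Poly_Mapping.keys m'" "YV i \<in> Poly_Mapping.keys n'"
      and deg: "multideg m' = multideg m" "multideg n' = multideg m" "ydeg c m' = ydeg c n'"
    for m' n' i
  proof -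
    have "c i \<in> Poly_Mapping.keys (ydeg c m')"
      using keys_ydegI[OF z(2)] deg by metis
    then obtain j where j: "YV j \<in> Poly_Mapping.keys m'" "c j = c i"
      by (rule keys_ydegE)
    obtain m1 where m1: "m' = m1 + Poly_Mapping.single (XV i) 1" using z(1) by (rule monomial_factor)
    have "YV j \<in> Poly_Mapping.keys m1" using j(1) unfolding m1 keys_add_nat by auto
    then obtain m2 where m2: "m1 = m2 + Poly_Mapping.single (YV j) 1" by (rule monomial_factor)
    define m3 where "m3 = m2 + Poly_Mapping.single (XV j) 1 + Poly_Mapping.single (YV i) 1"
    have "i \<in> Poly_Mapping.keys (multideg m)" "j \<in> Poly_Mapping.keys (multideg m)"
      using z(1) j(1) unfolding deg(1)[symmetric] keys_multideg by force+
    then have "i \<notin> T" "j \<notin> T" using less.prems(1) by auto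
    then have "i = j \<or> (i, j) \<in> E" using c j(2) unfolding class_map_def by metis
    then have "edge_binomial i j \<in> (J T E :: ('a edge_var, 'k) mpoly set)" by (auto intro: J_edge)
    moreover have "?s m' - ?s m3 = ?s m2 * edge_binomial i j"
      unfolding m1 m2 m3_def single_add_indet edge_binomial_def by (simp add: algebra_simps)
    ultimately have "?s m' - ?s m3 \<in> J T E" by (simp add: J_mult)
    moreover have "?s m3 - ?s n' \<in> J T E"
    proof (rule common)
      show "YV i \<in> Poly_Mapping.keys m3" by (simp add: m3_def keys_add_nat)
      show "multideg m3 = multideg m"
        unfolding deg(1)[symmetric] m1 m2 m3_def by (simp add: multideg_add add_ac)
      show "ydeg c m3 = ydeg c n'"
        unfolding deg(3)[symmetric] m1 m2 m3_def using j(2) by (simp add: ydeg_add add_ac)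
    qed (use z deg in auto)
    ultimately have "(?s m' - ?s m3) + (?s m3 - ?s n') \<in> J T E" by (rule J_add)
    then show ?thesis by simp
  qed
  show ?case
  proof (cases "m = 0")
    case True
    then have "multideg n = 0" using less.prems(2) by simp
    then have "n = 0" using keys_multideg[of n] by simp
    with True show ?thesis by simp
  next
    case False
    then obtain z where z: "z \<in> Poly_Mapping.keys m" by (metis keys_eq_empty all_not_in_conv)
    then have "vert z \<in> vert ` Poly_Mapping.keys n"
      using keys_multideg[of m] keys_multideg[of n] less.prems(2) by auto
    then obtain w where w: "w \<in> Poly_Mapping.keys n" "vert w = vert z" by force
    show ?thesis
    proof (cases "z = w")
      case True
      with w have "z \<in> Poly_Mapping.keys n" by simp
      then show ?thesis
        by (rule common[OF z _ refl less.prems(2)[symmetric] less.prems(3)])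
    next
      case neq: False
      then consider i where "z = XV i" "w = YV i" | i where "z = YV i" "w = XV i"
        using w(2) by (cases z; cases w) auto
      then show ?thesis
      proof cases
        case 1
        then have "XV i \<in> Poly_Mapping.keys m" "YV i \<in> Poly_Mapping.keys n"
          using z w by auto
        then show ?thesis
          by (rule swap[OF _ _ refl less.prems(2)[symmetric] less.prems(3)])
      next
        case 2
        then have "XV i \<in> Poly_Mapping.keys n" "YV i \<in> Poly_Mapping.keys m"
          using z w by auto
        then have "?s n - ?s m \<in> J T E"
          by (rule swap[OF _ _ less.prems(2)[symmetric] refl less.prems(3)[symmetric]])
        then show ?thesis using J_diff[OF J_zero, of "?s n - ?s m"] by simp
      qed
    qed
  qed
qed

text \<open>
  Modulo \<open>J T E\<close> each monomial may be replaced by a chosen representative of its fibre under the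
  toric map, or by \<open>0\<close> if it involves a killed vertex. The coefficients that result are those of
  the image under the toric map.
\<close>

lemma toric_kernel:
  fixes p :: "('v edge_var, 'k::field) mpoly"
  assumes c: "class_map T E c" and "toric T c p = 0"
  shows "p \<in> J T E"
proof -
  define rep where "rep m = (SOME n. multideg n = multideg m \<and> ydeg c n = ydeg c m)" for m
  have rep: "multideg (rep m) = multideg m \<and> ydeg c (rep m) = ydeg c m" for m
    unfolding rep_def by (rule someI[of _ m]) simp
  have rep_eq: "rep m = rep n \<longleftrightarrow> multideg m = multideg n \<and> ydeg c m = ydeg c n" for m n
  proof
    assume "rep m = rep n"
    then show "multideg m = multideg n \<and> ydeg c m = ydeg c n" using rep by metis
  next
    assume "multideg m = multideg n \<and> ydeg c m = ydeg c n"
    then show "rep m = rep n" by (simp add: rep_def)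
  qed
  let ?h = "\<lambda>m (a::'k). if Poly_Mapping.keys (multideg m) \<inter> T = {} then Poly_Mapping.single (rep m) a else 0"
  have add: "coeff_additive ?h"
    by (auto simp: coeff_additive_def single_add)
  have nf: "p - extend ?h p \<in> J T E" for p
  proof (induction p rule: poly_mapping_add_induct)
    case (single m a)
    show ?case
    proof (cases "Poly_Mapping.keys (multideg m) \<inter> T = {}")
      case True
      then show ?thesis
        using single_diff_in_J[OF c True, of "rep m" a] rep by (simp add: extend_single[OF add])
    next
      case False
      then show ?thesis
        using single_killed_in_J[OF False] by (simp add: extend_single[OF add])
    qed
  next
    case (add p q)
    from J_add[OF add] show ?case by (simp add: extend_add[OF \<open>coeff_additive ?h\<close>] algebra_simps)
  qed simp
  have "Poly_Mapping.lookup (extend ?h p) M = (if rep M = M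
      then Poly_Mapping.lookup (Poly_Mapping.lookup (toric T c p) (multideg M)) (ydeg c M) else 0)" for p M
  proof (induction p rule: poly_mapping_add_induct)
    case (single m a)
    have "rep m = M \<longleftrightarrow> rep M = M \<and> multideg m = multideg M \<and> ydeg c m = ydeg c M"
      using rep_eq rep by metis
    then show ?case
      by (auto simp: extend_single[OF add] toric_single lookup_single when_def)
  next
    case (add p q)
    then show ?case by (simp add: extend_add[OF \<open>coeff_additive ?h\<close>] toric_add lookup_add)
  qed simp
  then have "extend ?h p = 0"
    using assms(2) by (intro poly_mapping_eqI) simp
  then show ?thesis using nf[of p] by simp
qed

lemma J_iff_toric:
  assumes "class_map T E c"
  shows "p \<in> J T E \<longleftrightarrow> toric T c p = 0"
proof
  assume "p \<in> J T E" then show "toric T c p = 0" by (rule toric_J[OF assms])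
next
  assume "toric T c p = 0" then show "p \<in> J T E" by (rule toric_kernel[OF assms])
qed

lemma J_cluster_prime:
  fixes p q :: "('v::linorder edge_var, 'k::field) mpoly"
  assumes "cluster T E" "p * q \<in> J T E"
  shows "p \<in> J T E \<or> q \<in> J T E"
proof -
  obtain c where c: "class_map T E c" using cluster_class_map[OF assms(1)] ..
  show ?thesis using assms(2) unfolding J_iff_toric[OF c] toric_mult mult_eq_0_iff .
qed

lemma one_notin_J_cluster:
  assumes "cluster T E"
  shows "(1 :: ('v edge_var, 'k::field) mpoly) \<notin> J T E"
proof -
  obtain c where c: "class_map T E c" using cluster_class_map[OF assms(1)] ..
  have "toric T c (1 :: ('v edge_var, 'k) mpoly) = 1"
    using toric_single[of T c 0 "1::'k"] by simp
  then show ?thesis unfolding J_iff_toric[OF c] by simp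
qed


section \<open>Decomposition into cluster ideals\<close>

text \<open>
  Splitting is repeated until every ideal belongs to a cluster graph: each step kills a vertex or adds
  a pair. The added pairs stay inside any symmetric and transitive \<open>S\<close> that contains the relation;
  for a disjoint union this keeps the two parts unconnected.
\<close>

lemma J_decomposition:
  fixes T :: "'v set"
  assumes "finite V" "T \<subseteq> V" "E0 \<subseteq> E" "E \<subseteq> S" "S \<subseteq> V \<times> V" "sym E" "trans S" "sym S"
  shows "\<exists>F. finite F \<and> F \<noteq> {} \<and>
    (\<forall>q\<in>F. fst q \<subseteq> V \<and> E0 \<subseteq> snd q \<and> snd q \<subseteq> S \<and> cluster (fst q) (snd q)) \<and>
    (J T E :: ('v edge_var, 'k::field) mpoly set) = (\<Inter>q\<in>F. J (fst q) (snd q))"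
  using assms
proof (induction "card (V - T) + card (V \<times> V - E)" arbitrary: T E rule: less_induct)
  case (less T E)
  show ?case
  proof (cases "cluster T E")
    case True
    with less.prems show ?thesis by (intro exI[of _ "{(T, E)}"]) simp
  next
    case False
    then obtain i v j where ivj: "(i, v) \<in> E" "(v, j) \<in> E" "v \<notin> T" "i \<noteq> j" "(i, j) \<notin> E"
      using \<open>sym E\<close> unfolding cluster_def by blast
    then have neq: "i \<noteq> v" "j \<noteq> v" by auto
    define E' where "E' = E \<union> {(i, j), (j, i)}"
    have fin: "finite (V \<times> V)" "finite V" using less.prems by auto
    have mem: "(i, j) \<in> V \<times> V" "v \<in> V" using ivj less.prems by auto
    have sE': "sym E'" using \<open>sym E\<close> unfolding E'_def sym_def by blast
    have "(i, j) \<in> S" using ivj less.prems by (meson subsetD transD)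
    then have E'S: "E' \<subseteq> S" using less.prems unfolding E'_def by (auto dest: symD)
    have "card (V - insert v T) < card (V - T)"
      by (rule psubset_card_mono) (use ivj mem fin in auto)
    then have 1: "card (V - insert v T) + card (V \<times> V - E) < card (V - T) + card (V \<times> V - E)"
      by simp
    have "card (V \<times> V - E') < card (V \<times> V - E)"
      by (rule psubset_card_mono) (use ivj mem fin in \<open>auto simp: E'_def\<close>)
    then have 2: "card (V - T) + card (V \<times> V - E') < card (V - T) + card (V \<times> V - E)"
      by simp
    have T': "insert v T \<subseteq> V" and E0': "E0 \<subseteq> E'"
      using mem less.prems by (auto simp: E'_def)
    obtain F1 where F1: "finite F1" "F1 \<noteq> {}"
      "\<forall>q\<in>F1. fst q \<subseteq> V \<and> E0 \<subseteq> snd q \<and> snd q \<subseteq> S \<and> cluster (fst q) (snd q)"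
      "(J (insert v T) E :: ('v edge_var, 'k) mpoly set) = (\<Inter>q\<in>F1. J (fst q) (snd q))"
      using less.hyps[OF 1 less.prems(1) T' less.prems(3-)] by (elim exE conjE) (rule that)
    obtain F2 where F2: "finite F2" "F2 \<noteq> {}"
      "\<forall>q\<in>F2. fst q \<subseteq> V \<and> E0 \<subseteq> snd q \<and> snd q \<subseteq> S \<and> cluster (fst q) (snd q)"
      "(J T E' :: ('v edge_var, 'k) mpoly set) = (\<Inter>q\<in>F2. J (fst q) (snd q))"
      using less.hyps[OF 2 less.prems(1,2) E0' E'S less.prems(5) sE' less.prems(7-)]
      by (elim exE conjE) (rule that)
    have "(J T E :: ('v edge_var, 'k) mpoly set) = J (insert v T) E \<inter> J T E'"
      unfolding E'_def by (rule J_split[OF ivj(1,2) neq])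
    also have "\<dots> = (\<Inter>q\<in>F1 \<union> F2. J (fst q) (snd q))"
      unfolding F1(4) F2(4) INT_Un ..
    finally have "(J T E :: ('v edge_var, 'k) mpoly set) = (\<Inter>q\<in>F1 \<union> F2. J (fst q) (snd q))" .
    moreover have "\<forall>q\<in>F1 \<union> F2. fst q \<subseteq> V \<and> E0 \<subseteq> snd q \<and> snd q \<subseteq> S \<and> cluster (fst q) (snd q)"
      using F1(3) F2(3) by (simp only: ball_Un)
    ultimately show ?thesis
      using F1(1,2) F2(1) by (intro exI[of _ "F1 \<union> F2"] conjI) simp_all
  qed
qed


section \<open>Homogeneous elements\<close>

lemma homogeneous_iff:
  "p \<in> homogeneous_part (vert -` A) d \<longleftrightarrow> (\<forall>m\<in>Poly_Mapping.keys p. Poly_Mapping.keys m \<subseteq> vert -` A \<and> total_degree m = d)"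
  by (auto simp: homogeneous_part_def poly_ring_def)

lemma homogeneous_in_pcarrier: "p \<in> homogeneous_part (vert -` A) d \<Longrightarrow> p \<in> pcarrier A"
  by (simp add: homogeneous_part_def)

lemma homogeneous_one: "1 \<in> homogeneous_part (vert -` A) 0"
  by (simp add: homogeneous_iff)

lemma homogeneous_indet: "vert z \<in> A \<Longrightarrow> indet z \<in> homogeneous_part (vert -` A) 1"
  by (simp add: homogeneous_iff indet_def)

lemma homogeneous_mult:
  assumes "p \<in> homogeneous_part (vert -` A) d" "q \<in> homogeneous_part (vert -` A) e"
  shows "p * q \<in> homogeneous_part (vert -` A) (d + e)"
  unfolding homogeneous_iff
proof
  fix m assume "m \<in> Poly_Mapping.keys (p * q)"
  then obtain a b where "m = a + b" "a \<in> Poly_Mapping.keys p" "b \<in> Poly_Mapping.keys q"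
    using keys_mult by blast
  then show "Poly_Mapping.keys m \<subseteq> vert -` A \<and> total_degree m = d + e"
    using assms unfolding homogeneous_iff by (simp add: keys_add_nat total_degree_add)
qed

lemma keys_minus_subset: "Poly_Mapping.keys (p - q) \<subseteq> Poly_Mapping.keys p \<union> Poly_Mapping.keys q"
  for p q :: "'a \<Rightarrow>\<^sub>0 'b::ab_group_add"
  by (auto simp: in_keys_iff lookup_minus)

lemma homogeneous_minus:
  "p \<in> homogeneous_part (vert -` A) d \<Longrightarrow> q \<in> homogeneous_part (vert -` A) d
    \<Longrightarrow> p - q \<in> homogeneous_part (vert -` A) d"
  unfolding homogeneous_iff using keys_minus_subset[of p q] by blast

lemma homogeneous_edge_binomial:
  assumes "i \<in> A" "j \<in> A"
  shows "edge_binomial i j \<in> homogeneous_part (vert -` A) 2"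
proof -
  have "edge_binomial i j \<in> homogeneous_part (vert -` A) (1 + 1)"
    unfolding edge_binomial_def
    by (intro homogeneous_minus homogeneous_mult homogeneous_indet) (simp_all add: assms)
  then show ?thesis by (simp add: numeral_2_eq_2)
qed

lemma gens_homogeneous:
  assumes "g \<in> gens T E" "T \<subseteq> A" "E \<subseteq> A \<times> A"
  shows "\<exists>d. g \<in> homogeneous_part (vert -` A) d"
proof -
  from assms(1) consider z where "g = indet z" "vert z \<in> T" | i j where "g = edge_binomial i j" "(i, j) \<in> E"
    unfolding gens_def by blast
  then show ?thesis
  proof cases
    case 1
    then show ?thesis using homogeneous_indet[of z A] assms(2) by auto
  next
    case 2
    then show ?thesis using homogeneous_edge_binomial[of i A j] assms(3) by auto
  qed
qed

lemma pcarrier_mono: "A \<subseteq> B \<Longrightarrow> p \<in> pcarrier A \<Longrightarrow> p \<in> pcarrier B"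
  unfolding pcarrier_iff by blast

lemma pcarrier_mult: "p \<in> pcarrier A \<Longrightarrow> q \<in> pcarrier A \<Longrightarrow> p * q \<in> pcarrier A"
  by (metis retract_fixed retract_in retract_mult)

lemma pcarrier_add: "p \<in> pcarrier A \<Longrightarrow> q \<in> pcarrier A \<Longrightarrow> p + q \<in> pcarrier A"
  by (metis retract_fixed retract_in retract_add)

lemma pcarrier_minus: "p \<in> pcarrier A \<Longrightarrow> q \<in> pcarrier A \<Longrightarrow> p - q \<in> pcarrier A"
  by (metis retract_fixed retract_in retract_diff)

lemma pcarrier_zero: "0 \<in> pcarrier A" and pcarrier_one: "1 \<in> pcarrier A"
  by (simp_all add: pcarrier_iff)


section \<open>Colon ideals that are prime\<close>

text \<open>
  A product of elements that avoid \<open>P\<close>, one from each \<open>K q\<close>. The set \<open>A\<close> restricts the choice; it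
  will be a polynomial subring in one application and the set of homogeneous elements in another.
\<close>

lemma prime_avoidance:
  fixes A P :: "'a::comm_ring_1 set"
  assumes "finite F" and one: "1 \<in> A" "1 \<notin> P"
    and mult: "\<And>a b. a \<in> A \<Longrightarrow> b \<in> A \<Longrightarrow> a * b \<in> A"
    and prime: "\<And>a b. a \<in> A \<Longrightarrow> b \<in> A \<Longrightarrow> a * b \<in> P \<Longrightarrow> a \<in> P \<or> b \<in> P"
    and ex: "\<And>q. q \<in> F \<Longrightarrow> \<exists>g\<in>A. g \<in> K q \<and> g \<notin> P"
    and absorb: "\<And>q g r. g \<in> K q \<Longrightarrow> r * g \<in> K q"
  shows "\<exists>g\<in>A. g \<notin> P \<and> (\<forall>q\<in>F. g \<in> K q)"
  using assms(1) ex
proof (induction F rule: finite_induct)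
  case empty
  show ?case using one by auto
next
  case (insert q F)
  obtain g where g: "g \<in> A" "g \<notin> P" "\<forall>q\<in>F. g \<in> K q" using insert by auto
  obtain h where h: "h \<in> A" "h \<in> K q" "h \<notin> P" using insert.prems by auto
  show ?case
  proof (intro bexI[of _ "g * h"] conjI ballI)
    show "g * h \<notin> P" using prime[of g h] g h by auto
    fix q' assume "q' \<in> insert q F"
    then show "g * h \<in> K q'"
      using g h absorb[of h q g] absorb[of g q' h] by (auto simp: mult.commute)
  qed (simp add: mult g h)
qed

text \<open>
  A pair of a homogeneous \<open>f\<close> and a cluster prime \<open>J T E\<close> for which \<open>J T E\<close>, inside the polynomial
  ring on \<open>V\<close>, is the colon ideal of \<open>J {} E0\<close> by \<open>f\<close>. Instead of the equality it is enough to ask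
  that \<open>f\<close> is outside the prime and multiplies the prime into \<open>J {} E0\<close>: the other inclusion is then
  the definition of a prime. In this form witnesses behave well under products and linear maps.
  The relation \<open>S\<close> bounds \<open>E\<close>, so that the clusters of a disjoint union stay within the two parts.
\<close>

definition witness ::
  "'v set \<Rightarrow> ('v \<times> 'v) set \<Rightarrow> ('v \<times> 'v) set \<Rightarrow> nat \<Rightarrow> ('v edge_var, 'k::field) mpoly \<Rightarrow>
    'v set \<Rightarrow> ('v \<times> 'v) set \<Rightarrow> bool" where
  "witness V S E0 d f T E \<longleftrightarrow>
     f \<in> homogeneous_part (vert -` V) d \<and> T \<subseteq> V \<and> E0 \<subseteq> E \<and> E \<subseteq> S \<and> cluster T E \<and>
     f \<notin> J T E \<and> (\<forall>p\<in>pcarrier V. p \<in> J T E \<longrightarrow> f * p \<in> J {} E0)"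

text \<open>
  Take a minimal component of the decomposition and an element outside of it that lies in all the
  other components. It can be chosen homogeneous, as a product of generators.
\<close>

lemma witness_exists:
  fixes V :: "'v::linorder set"
  assumes V: "finite V" "S \<subseteq> V \<times> V" "sym S" "trans S" and E0: "sym E0" "E0 \<subseteq> S"
  shows "\<exists>d (f :: ('v edge_var, 'k::field) mpoly) T E. witness V S E0 d f T E"
proof -
  let ?J = "\<lambda>q. J (fst q) (snd q) :: ('v edge_var, 'k) mpoly set"
  obtain F where F: "finite F" "F \<noteq> {}"
    and FE': "\<forall>q\<in>F. fst q \<subseteq> V \<and> E0 \<subseteq> snd q \<and> snd q \<subseteq> S \<and> cluster (fst q) (snd q)"
    and I: "(J {} E0 :: ('v edge_var, 'k) mpoly set) = (\<Inter>q\<in>F. ?J q)"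
    using J_decomposition[where 'k = 'k, OF V(1) empty_subsetI subset_refl E0(2) V(2) E0(1) V(4,3)]
    by (elim exE conjE) (rule that)
  note FE = FE'[rule_format]
  \<comment> \<open>Different cluster graphs may have the same ideal, so the ideals and not the graphs are compared.\<close>
  obtain M where M: "M \<in> ?J ` F" "\<forall>M'\<in>?J ` F. M' \<subseteq> M \<longrightarrow> M = M'"
    using finite_has_minimal[of "?J ` F"] F by blast
  then obtain q where "q \<in> F" "M = ?J q" by blast
  with M(2) have q: "q \<in> F" "\<And>q'. q' \<in> F \<Longrightarrow> ?J q' \<subseteq> ?J q \<Longrightarrow> ?J q' = ?J q"
    by blast+
  have "\<exists>f\<in>{f. \<exists>d. f \<in> homogeneous_part (vert -` V) d}. f \<notin> ?J q \<and> (\<forall>q'\<in>{q'\<in>F. \<not> ?J q' \<subseteq> ?J q}. f \<in> ?J q')"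
  proof (rule prime_avoidance)
    fix q' assume "q' \<in> {q' \<in> F. \<not> ?J q' \<subseteq> ?J q}"
    then have q': "q' \<in> F" "\<not> ?J q' \<subseteq> ?J q" by auto
    then obtain g :: "('v edge_var, 'k) mpoly" where g: "g \<in> gens (fst q') (snd q')" "g \<notin> ?J q"
      using J_least by blast
    then have "g \<in> ?J q'" unfolding J_def by (intro gen.span_base)
    moreover have "\<exists>d. g \<in> homogeneous_part (vert -` V) d"
      using gens_homogeneous[OF g(1)] FE[OF q'(1)] V by blast
    ultimately show "\<exists>g\<in>{f. \<exists>d. f \<in> homogeneous_part (vert -` V) d}. g \<in> ?J q' \<and> g \<notin> ?J q"
      using g by blast
  qed (use F FE[OF q(1)] in \<open>auto intro: homogeneous_one homogeneous_mult J_mult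
        dest: J_cluster_prime simp: one_notin_J_cluster\<close>)
  then obtain f d where f: "f \<in> homogeneous_part (vert -` V) d" "f \<notin> ?J q"
    and fJ: "\<And>q'. q' \<in> F \<Longrightarrow> \<not> ?J q' \<subseteq> ?J q \<Longrightarrow> f \<in> ?J q'" by auto
  have "f * p \<in> ?J q'" if "p \<in> ?J q" "q' \<in> F" for p q'
  proof (cases "?J q' \<subseteq> ?J q")
    case True
    then show ?thesis using q(2)[OF that(2)] that J_mult by blast
  next
    case False
    then show ?thesis using fJ that J_mult_right by blast
  qed
  then have "witness V S E0 d f (fst q) (snd q)"
    unfolding witness_def I using f FE[OF q(1)] by auto
  then show ?thesis by blast
qed

section \<open>v-numbers as least degrees of witnesses\<close>

lemma poly_ring_simps:
  "mult (poly_ring X) = (*)" "one (poly_ring X) = 1" "zero (poly_ring X) = 0" "add (poly_ring X) = (+)"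
  by (simp_all add: poly_ring_def)

lemma poly_ring_cring: "cring (poly_ring (vert -` A) :: ('v edge_var, 'k::field) mpoly ring)"
proof (intro cringI abelian_groupI comm_monoidI)
  fix p :: "('v edge_var, 'k) mpoly" assume p: "p \<in> pcarrier A"
  then have "- p \<in> pcarrier A" using pcarrier_minus[OF pcarrier_zero p] by simp
  then show "\<exists>y\<in>pcarrier A. y \<oplus>\<^bsub>poly_ring (vert -` A)\<^esub> p = \<zero>\<^bsub>poly_ring (vert -` A)\<^esub>"
    by (intro bexI[of _ "- p"]) (simp_all add: poly_ring_simps)
qed (auto simp: poly_ring_simps pcarrier_add pcarrier_mult pcarrier_zero pcarrier_one algebra_simps)

lemma J_ideal: "ideal (J T E \<inter> pcarrier A) (poly_ring (vert -` A))"
proof (rule idealI)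
  interpret cring "poly_ring (vert -` A)" by (rule poly_ring_cring)
  show "ring (poly_ring (vert -` A))" by (rule ring_axioms)
  show "subgroup (J T E \<inter> pcarrier A) (add_monoid (poly_ring (vert -` A)))"
  proof (rule add.subgroupI)
    fix p assume p: "p \<in> J T E \<inter> pcarrier A"
    have "\<ominus>\<^bsub>poly_ring (vert -` A)\<^esub> p = - p"
      by (rule minus_equality) (use p pcarrier_minus[OF pcarrier_zero, of p A] in \<open>auto simp: poly_ring_simps\<close>)
    then show "\<ominus>\<^bsub>poly_ring (vert -` A)\<^esub> p \<in> J T E \<inter> pcarrier A"
      using p J_diff[OF J_zero, of p T E] pcarrier_minus[OF pcarrier_zero, of p A] by simp
  qed (auto simp: poly_ring_simps J_add pcarrier_add intro: pcarrier_zero J_zero)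
qed (auto simp: poly_ring_simps J_mult J_mult_right pcarrier_mult)

definition arcs :: "'v graph \<Rightarrow> ('v \<times> 'v) set" where
  "arcs G = {(i, j). {i, j} \<in> edges G}"

lemma sym_arcs: "sym (arcs G)"
  by (auto simp: sym_def arcs_def insert_commute)

lemma arcs_subset: "finite_simple_graph G \<Longrightarrow> arcs G \<subseteq> verts G \<times> verts G"
  by (auto simp: finite_simple_graph_def arcs_def)

text \<open>
  Retracting a combination of generators to the vertices of \<open>G\<close> turns its coefficients into
  polynomials on these vertices and leaves the generators as they are.
\<close>

lemma binomial_edge_ideal_eq:
  fixes G :: "'v::linorder graph"
  assumes "finite_simple_graph G"
  shows "(binomial_edge_ideal G :: ('v edge_var, 'k::field) mpoly set)
           = J {} (arcs G) \<inter> pcarrier (verts G)"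
proof
  let ?R = "poly_ring (vert -` verts G) :: ('v edge_var, 'k) mpoly ring"
  let ?S = "{edge_binomial i j | i j. {i, j} \<in> edges G \<and> i < j} :: ('v edge_var, 'k) mpoly set"
  interpret R: cring ?R by (rule poly_ring_cring)
  have S: "?S \<subseteq> J {} (arcs G) \<inter> carrier ?R"
    using arcs_subset[OF assms]
    by (auto simp: arcs_def intro!: J_edge homogeneous_in_pcarrier homogeneous_edge_binomial)
  show "binomial_edge_ideal G \<subseteq> J {} (arcs G) \<inter> carrier ?R"
    unfolding binomial_edge_ideal_def edge_vars_eq by (rule R.genideal_minimal[OF J_ideal S])
  show "J {} (arcs G) \<inter> carrier ?R \<subseteq> binomial_edge_ideal G"
  proof
    fix p assume p: "p \<in> J {} (arcs G) \<inter> carrier ?R"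
    interpret I: ideal "Idl\<^bsub>?R\<^esub> ?S" ?R
      by (rule R.genideal_ideal) (use S in blast)
    \<comment> \<open>The generators of the binomial edge ideal are ordered, those of \<open>J\<close> come in both orders.\<close>
    have base: "edge_binomial i j \<in> Idl\<^bsub>?R\<^esub> ?S" if "{i, j} \<in> edges G" for i j
    proof -
      have sub: "?S \<subseteq> Idl\<^bsub>?R\<^esub> ?S" by (rule R.genideal_self) (use S in blast)
      have "i \<noteq> j" using that assms by (force simp: finite_simple_graph_def)
      then consider "i < j" | "j < i" by fastforce
      then show ?thesis
      proof cases
        case 1
        then show ?thesis using sub that by blast
      next
        case 2
        moreover have "{j, i} \<in> edges G" using that by (simp add: insert_commute)
        ultimately have "edge_binomial j i \<in> ?S" by blast
        with sub have ji: "edge_binomial j i \<in> Idl\<^bsub>?R\<^esub> ?S" by (rule subsetD)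
        have "- 1 \<in> carrier ?R"
          using pcarrier_minus[OF pcarrier_zero pcarrier_one, of "verts G"] by simp
        from I.I_l_closed[OF ji this] show ?thesis
          by (simp add: poly_ring_simps edge_binomial_swap[of j i])
      qed
    qed
    have "retract (verts G) p \<in> Idl\<^bsub>?R\<^esub> ?S"
      if "p \<in> J {} (arcs G)" for p :: "('v edge_var, 'k) mpoly"
      using that
    proof (induction rule: J_induct)
      case zero
      show ?case using I.zero_closed by (simp add: poly_ring_simps)
    next
      case (step r g q)
      obtain i j where g: "g = edge_binomial i j" "(i, j) \<in> arcs G"
        using step.hyps by (auto simp: gens_def)
      have "retract (verts G) r * edge_binomial i j \<in> Idl\<^bsub>?R\<^esub> ?S"
        using I.I_l_closed[OF base retract_in, of i j] g by (simp add: poly_ring_simps arcs_def)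
      moreover have "retract (verts G) g = edge_binomial i j"
        using g arcs_subset[OF assms] by (auto simp: retract_edge_binomial)
      ultimately show ?case
        using I.a_closed step.IH by (simp add: retract_add retract_mult poly_ring_simps)
    qed
    from this[of p] show "p \<in> binomial_edge_ideal G"
      unfolding binomial_edge_ideal_def edge_vars_eq using p retract_fixed[of p] by simp
  qed
qed

text \<open>
  A colon ideal by \<open>f\<close> is the annihilator of the class of \<open>f\<close>, so it is associated as soon as it
  is prime.
\<close>

lemma colon_in_Ass_iff:
  assumes I: "ideal I R" and R: "cring R" and f: "f \<in> carrier R"
  shows "(\<exists>P\<in>Ass R I. colon R I f = P) \<longleftrightarrow> primeideal (colon R I f) R"
proof
  assume "\<exists>P\<in>Ass R I. colon R I f = P"
  then show "primeideal (colon R I f) R" by (auto simp: Ass_def)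
next
  interpret cring R by (rule R)
  interpret I: ideal I R by (rule I)
  assume prime: "primeideal (colon R I f) R"
  have "I +>\<^bsub>R\<^esub> f \<in> carrier (R Quot I)"
    using f by (auto simp: FactRing_def A_RCOSETS_def' a_r_coset_def')
  moreover have "(I +>\<^bsub>R\<^esub> r) \<otimes>\<^bsub>R Quot I\<^esub> (I +>\<^bsub>R\<^esub> f) = \<zero>\<^bsub>R Quot I\<^esub> \<longleftrightarrow> r \<otimes>\<^bsub>R\<^esub> f \<in> I"
    if "r \<in> carrier R" for r
  proof -
    have "(I +>\<^bsub>R\<^esub> r) \<otimes>\<^bsub>R Quot I\<^esub> (I +>\<^bsub>R\<^esub> f) = I +>\<^bsub>R\<^esub> (r \<otimes>\<^bsub>R\<^esub> f)"
      using I.rcoset_mult_add[OF that f] by (simp add: FactRing_def)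
    moreover have "I +>\<^bsub>R\<^esub> (r \<otimes>\<^bsub>R\<^esub> f) = I \<longleftrightarrow> r \<otimes>\<^bsub>R\<^esub> f \<in> I"
      using I.a_rcos_const I.a_rcos_self[of "r \<otimes>\<^bsub>R\<^esub> f"] that f by auto
    ultimately show ?thesis by (simp add: FactRing_def)
  qed
  then have "colon R I f = {r \<in> carrier R. (I +>\<^bsub>R\<^esub> r) \<otimes>\<^bsub>R Quot I\<^esub> (I +>\<^bsub>R\<^esub> f) = \<zero>\<^bsub>R Quot I\<^esub>}"
    by (auto simp: colon_def)
  ultimately have "colon R I f \<in> Ass R I"
    unfolding Ass_def using prime by blast
  then show "\<exists>P\<in>Ass R I. colon R I f = P" by blast
qed

text \<open>
  A prime colon ideal by \<open>f\<close> contains the intersection of those components of \<open>J {} E0\<close> that do not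
  contain \<open>f\<close>, hence one of these components, and this is the prime of the witness.
\<close>

lemma colon_prime_iff_witness:
  fixes f :: "('v::linorder edge_var, 'k::field) mpoly"
  assumes V: "finite V" "S \<subseteq> V \<times> V" "sym S" "trans S" and E0: "sym E0" "E0 \<subseteq> S"
    and f: "f \<in> homogeneous_part (vert -` V) d"
  shows "primeideal (colon (poly_ring (vert -` V)) (J {} E0 \<inter> pcarrier V) f) (poly_ring (vert -` V))
    \<longleftrightarrow> (\<exists>T E. witness V S E0 d f T E)" (is "primeideal ?P ?R \<longleftrightarrow> _")
proof
  have fV: "f \<in> pcarrier V" by (rule homogeneous_in_pcarrier[OF f])
  have P: "g \<in> ?P \<longleftrightarrow> g \<in> pcarrier V \<and> g * f \<in> J {} E0" for g
    using fV by (auto simp: colon_def poly_ring_simps pcarrier_mult)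
  {
    assume prime: "primeideal ?P ?R"
    interpret P: primeideal ?P ?R by (rule prime)
    let ?J = "\<lambda>q. J (fst q) (snd q) :: ('v edge_var, 'k) mpoly set"
    obtain F where F: "finite F" "F \<noteq> {}"
      and FE': "\<forall>q\<in>F. fst q \<subseteq> V \<and> E0 \<subseteq> snd q \<and> snd q \<subseteq> S \<and> cluster (fst q) (snd q)"
      and I: "(J {} E0 :: ('v edge_var, 'k) mpoly set) = (\<Inter>q\<in>F. ?J q)"
      using J_decomposition[where 'k = 'k, OF V(1) empty_subsetI subset_refl E0(2) V(2) E0(1) V(4,3)]
      by (elim exE conjE) (rule that)
    note FE = FE'[rule_format]
    have "\<exists>q\<in>{q\<in>F. f \<notin> ?J q}. \<forall>g\<in>pcarrier V. g \<in> ?J q \<longrightarrow> g \<in> ?P"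
    proof (rule ccontr)
      assume "\<not> ?thesis"
      then have *: "\<exists>g\<in>pcarrier V. g \<in> ?J q \<and> g \<notin> ?P" if "q \<in> {q\<in>F. f \<notin> ?J q}" for q
        using that by blast
      have "\<exists>g\<in>pcarrier V. g \<notin> ?P \<and> (\<forall>q\<in>{q\<in>F. f \<notin> ?J q}. g \<in> ?J q)"
      proof (rule prime_avoidance)
        show "1 \<notin> ?P"
          using P.one_imp_carrier P.I_notcarr by (auto simp: poly_ring_simps)
        show "a \<in> ?P \<or> b \<in> ?P" if "a \<in> pcarrier V" "b \<in> pcarrier V" "a * b \<in> ?P" for a b
          using P.I_prime[of a b] that by (simp add: poly_ring_simps)
      qed (use F * in \<open>auto intro: pcarrier_one pcarrier_mult J_mult\<close>)
      then obtain g where g: "g \<in> pcarrier V" "g \<notin> ?P" "\<And>q. q \<in> F \<Longrightarrow> f \<notin> ?J q \<Longrightarrow> g \<in> ?J q"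
        by auto
      have "g * f \<in> ?J q" if "q \<in> F" for q
        using g(3)[OF that] J_mult J_mult_right by blast
      then have "g * f \<in> J {} E0" unfolding I by blast
      then show False using g P by blast
    qed
    then obtain q where q: "q \<in> F" "f \<notin> ?J q" "\<And>g. g \<in> pcarrier V \<Longrightarrow> g \<in> ?J q \<Longrightarrow> g \<in> ?P"
      by auto
    have "f * p \<in> J {} E0" if "p \<in> pcarrier V" "p \<in> ?J q" for p
      using q(3)[OF that] P[of p] by (simp add: mult.commute)
    then have "witness V S E0 d f (fst q) (snd q)"
      unfolding witness_def using f FE[OF q(1)] q(2) by blast
    then show "\<exists>T E. witness V S E0 d f T E" by blast
  next
    assume "\<exists>T E. witness V S E0 d f T E"
    then obtain T E where w: "witness V S E0 d f T E" by blast
    then have cl: "cluster T E" and fJ: "f \<notin> J T E" by (auto simp: witness_def)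
    have "?P = J T E \<inter> pcarrier V"
    proof (intro equalityI subsetI)
      fix g assume "g \<in> ?P"
      then have g: "g \<in> pcarrier V" "g * f \<in> J {} E0" using P by auto
      from w have "{} \<subseteq> T" "E0 \<subseteq> E" by (auto simp: witness_def)
      with g(2) have "g * f \<in> J T E" by (rule J_mono)
      then show "g \<in> J T E \<inter> pcarrier V" using J_cluster_prime[OF cl] fJ g by blast
    next
      fix g :: "('v edge_var, 'k) mpoly"
      assume g: "g \<in> J T E \<inter> pcarrier V"
      then have "f * g \<in> J {} E0" using w unfolding witness_def by blast
      then show "g \<in> ?P" using g P[of g] by (simp add: mult.commute)
    qed
    moreover have "primeideal (J T E \<inter> pcarrier V) ?R"
    proof (rule primeidealI[OF J_ideal poly_ring_cring])
      show "carrier ?R \<noteq> J T E \<inter> pcarrier V"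
        using pcarrier_one[of V] one_notin_J_cluster[OF cl] by blast
    qed (auto simp: poly_ring_simps dest: J_cluster_prime[OF cl])
    ultimately show "primeideal ?P ?R" by simp
  }
qed

lemma v_number_eq_Least_witness:
  fixes G :: "'v::linorder graph"
  assumes G: "finite_simple_graph G"
    and S: "arcs G \<subseteq> S" "S \<subseteq> verts G \<times> verts G" "sym S" "trans S"
  shows "v_number (edge_vars G) (binomial_edge_ideal G :: ('v edge_var, 'k::field) mpoly set)
    = (LEAST d. \<exists>(f :: ('v edge_var, 'k) mpoly) T E. witness (verts G) S (arcs G) d f T E)"
proof -
  have fin: "finite (verts G)" using G by (simp add: finite_simple_graph_def)
  let ?R = "poly_ring (vert -` verts G) :: ('v edge_var, 'k) mpoly ring"
  let ?I = "J {} (arcs G) \<inter> pcarrier (verts G) :: ('v edge_var, 'k) mpoly set"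
  have iff: "(\<exists>P\<in>Ass ?R ?I. colon ?R ?I f = P) \<longleftrightarrow> (\<exists>T E. witness (verts G) S (arcs G) d f T E)"
    if f: "f \<in> homogeneous_part (vert -` verts G) d" for f :: "('v edge_var, 'k) mpoly" and d
    using colon_in_Ass_iff[OF J_ideal poly_ring_cring homogeneous_in_pcarrier[OF f]]
      colon_prime_iff_witness[OF fin S(2-4) sym_arcs S(1) f] by (rule HOL.trans)
  have "f \<in> homogeneous_part (vert -` verts G) d"
    if "witness (verts G) S (arcs G) d f T E" for f :: "('v edge_var, 'k) mpoly" and d T E
    using that by (simp add: witness_def)
  with iff have "(\<exists>f\<in>homogeneous_part (vert -` verts G) d. \<exists>P\<in>Ass ?R ?I. colon ?R ?I f = P)
      \<longleftrightarrow> (\<exists>f T E. witness (verts G) S (arcs G) d (f :: ('v edge_var, 'k) mpoly) T E)" for d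
    by blast
  then show ?thesis
    unfolding v_number_def binomial_edge_ideal_eq[OF G] edge_vars_eq by simp
qed


section \<open>Slices along a fibre of the toric map\<close>

definition mrestrict :: "'v set \<Rightarrow> ('v edge_var \<Rightarrow>\<^sub>0 nat) \<Rightarrow> ('v edge_var \<Rightarrow>\<^sub>0 nat)" where
  "mrestrict A = extend (\<lambda>z n. if vert z \<in> A then Poly_Mapping.single z n else 0)"

lemma mrestrict_additive:
  "coeff_additive (\<lambda>z (n::nat). if vert z \<in> A then Poly_Mapping.single z n else 0)"
  by (simp add: coeff_additive_def single_add)

lemma mrestrict_zero [simp]: "mrestrict A 0 = 0"
  by (simp add: mrestrict_def)

lemma mrestrict_add: "mrestrict A (m + n) = mrestrict A m + mrestrict A n"
  unfolding mrestrict_def by (rule extend_add[OF mrestrict_additive])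

lemma mrestrict_single [simp]:
  "mrestrict A (Poly_Mapping.single z n) = (if vert z \<in> A then Poly_Mapping.single z n else 0)"
  unfolding mrestrict_def by (rule extend_single[OF mrestrict_additive])

lemma lookup_mrestrict:
  "Poly_Mapping.lookup (mrestrict A m) z = (if vert z \<in> A then Poly_Mapping.lookup m z else 0)"
  by (induction m rule: poly_mapping_add_induct)
    (auto simp: mrestrict_add lookup_add lookup_single when_def)

lemma keys_mrestrict: "Poly_Mapping.keys (mrestrict A m) = Poly_Mapping.keys m \<inter> vert -` A"
  by (auto simp: in_keys_iff lookup_mrestrict split: if_splits)

lemma mrestrict_decompose: "m = mrestrict A m + mrestrict (- A) m"
  by (rule poly_mapping_eqI) (simp add: lookup_add lookup_mrestrict)

lemma mrestrict_inside:
  assumes "Poly_Mapping.keys m \<subseteq> vert -` A"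
  shows "mrestrict A m = m" "mrestrict (- A) m = 0"
proof -
  have "Poly_Mapping.lookup m z = 0" if "vert z \<notin> A" for z
    using assms that by (auto simp: in_keys_iff)
  then show "mrestrict A m = m" "mrestrict (- A) m = 0"
    by (auto intro!: poly_mapping_eqI simp: lookup_mrestrict)
qed

text \<open>
  Split each monomial into its part on \<open>A\<close> and its part outside \<open>A\<close>, keep the terms whose outside part
  has the toric image \<open>(U, W)\<close>, and forget the outside part. This is a functional on the polynomials
  outside \<open>A\<close> that factors through the toric map, extended linearly over the polynomial ring on \<open>A\<close>.
\<close>

definition slice :: "('v \<Rightarrow> 'v) \<Rightarrow> 'v set \<Rightarrow> ('v \<Rightarrow>\<^sub>0 nat) \<Rightarrow> ('v \<Rightarrow>\<^sub>0 nat)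
    \<Rightarrow> ('v edge_var, 'k::field) mpoly \<Rightarrow> ('v edge_var, 'k) mpoly" where
  "slice c A U W = extend (\<lambda>m a.
     if multideg (mrestrict (- A) m) = U \<and> ydeg c (mrestrict (- A) m) = W
     then Poly_Mapping.single (mrestrict A m) a else 0)"

lemma slice_additive:
  "coeff_additive (\<lambda>m a.
     if multideg (mrestrict (- A) m) = U \<and> ydeg c (mrestrict (- A) m) = W
     then Poly_Mapping.single (mrestrict A m) a else 0)"
  by (auto simp: coeff_additive_def single_add)

lemma slice_zero [simp]: "slice c A U W 0 = 0"
  by (simp add: slice_def)

lemma slice_add: "slice c A U W (p + q) = slice c A U W p + slice c A U W q"
  unfolding slice_def by (rule extend_add[OF slice_additive])

lemma slice_diff: "slice c A U W (p - q) = slice c A U W p - slice c A U W q"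
  unfolding slice_def by (rule extend_diff[OF slice_additive])

lemma slice_single:
  "slice c A U W (Poly_Mapping.single m a) =
     (if multideg (mrestrict (- A) m) = U \<and> ydeg c (mrestrict (- A) m) = W
      then Poly_Mapping.single (mrestrict A m) a else 0)"
  unfolding slice_def by (rule extend_single[OF slice_additive])

lemma slice_mult:
  assumes "p \<in> pcarrier A"
  shows "slice c A U W (p * q) = p * slice c A U W q"
proof (induction p rule: poly_mapping_add_induct)
  case (single m a)
  then have m: "Poly_Mapping.keys m \<subseteq> vert -` A"
    using assms by (simp add: pcarrier_iff)
  show ?case
  proof (induction q rule: poly_mapping_add_induct)
    case (single n b)
    show ?case
      by (simp add: mult_single slice_single mrestrict_add mrestrict_inside[OF m])
  qed (simp_all add: distrib_left slice_add)
qed (simp_all add: distrib_right slice_add)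

text \<open>
  The two terms of \<open>f_ij\<close> have the same toric image, so they cancel in a slice. If \<open>i\<close> or \<open>j\<close> is
  killed they do not occur in the slice, since \<open>U\<close> avoids \<open>T\<close>.
\<close>

lemma slice_edge_binomial:
  assumes c: "class_map T E c" and e: "(i, j) \<in> E" "i \<notin> A" "j \<notin> A"
    and U: "Poly_Mapping.keys U \<inter> T = {}"
  shows "slice c A U W (q * edge_binomial i j) = 0"
proof (induction q rule: poly_mapping_add_induct)
  case (single m a)
  let ?m1 = "m + Poly_Mapping.single (XV i) 1 + Poly_Mapping.single (YV j) 1"
  let ?m2 = "m + Poly_Mapping.single (XV j) 1 + Poly_Mapping.single (YV i) 1"
  have eq: "Poly_Mapping.single m a * edge_binomial i j
      = Poly_Mapping.single ?m1 a - Poly_Mapping.single ?m2 a"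
    unfolding single_add_indet edge_binomial_def by (simp add: algebra_simps)
  show ?case
  proof (cases "i \<in> T \<or> j \<in> T")
    case True
    have "i \<in> Poly_Mapping.keys (multideg (mrestrict (- A) m'))
        \<and> j \<in> Poly_Mapping.keys (multideg (mrestrict (- A) m'))" if "m' = ?m1 \<or> m' = ?m2" for m'
      using that e by (auto simp: mrestrict_add multideg_add keys_add_nat)
    then have "multideg (mrestrict (- A) m') \<noteq> U" if "m' = ?m1 \<or> m' = ?m2" for m'
      using that U True by blast
    then have "slice c A U W (Poly_Mapping.single ?m1 a) = 0" "slice c A U W (Poly_Mapping.single ?m2 a) = 0"
      unfolding slice_single by auto
    then show ?thesis unfolding eq slice_diff by simp
  next
    case False
    then have "c i = c j" using c e unfolding class_map_def by blast
    then show ?thesis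
      using e unfolding eq slice_diff slice_single
      by (simp add: mrestrict_add multideg_add ydeg_add add_ac)
  qed
qed (simp_all add: distrib_right slice_add)

lemma slice_J:
  assumes c: "class_map T E c" and E0: "E0 \<subseteq> E" "E0 \<subseteq> A \<times> A \<union> (- A) \<times> (- A)"
    and U: "Poly_Mapping.keys U \<inter> T = {}"
    and p: "p \<in> J {} E0"
  shows "slice c A U W p \<in> J {} (E0 \<inter> A \<times> A)"
  using p
proof (induction rule: J_induct)
  case (step r g q)
  then obtain i j where g: "g = edge_binomial i j" "(i, j) \<in> E0" by (auto simp: gens_def)
  have "slice c A U W (r * g) \<in> J {} (E0 \<inter> A \<times> A)"
  proof (cases "i \<in> A \<and> j \<in> A")
    case True
    then have "slice c A U W (r * g) = g * slice c A U W r"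
      using slice_mult[OF homogeneous_in_pcarrier[OF homogeneous_edge_binomial[of i A j]]]
      by (simp add: g mult.commute)
    then show ?thesis using True g by (simp add: J_mult_right J_edge)
  next
    case False
    then have "i \<notin> A" "j \<notin> A" using g E0 by auto
    moreover have "(i, j) \<in> E" using g E0 by auto
    ultimately show ?thesis by (simp add: g(1) slice_edge_binomial[OF c _ _ _ U])
  qed
  with step.IH show ?case by (simp add: slice_add J_add)
qed simp

text \<open>
  The part outside \<open>A\<close> of a monomial that occurs in the slice has total degree \<open>total_degree U\<close>, as
  the toric map keeps the total degree in the variables \<open>u\<close>.
\<close>

lemma slice_homogeneous:
  assumes "f \<in> homogeneous_part (vert -` V) d"
  shows "slice c A U W f \<in> homogeneous_part (vert -` A) (d - total_degree U)"
  unfolding homogeneous_iff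
proof
  fix n assume "n \<in> Poly_Mapping.keys (slice c A U W f)"
  then obtain m where m: "m \<in> Poly_Mapping.keys f" "multideg (mrestrict (- A) m) = U" "n = mrestrict A m"
    using keys_extend_subset unfolding slice_def by (fastforce split: if_splits)
  have "d = total_degree m" using assms m(1) by (simp add: homogeneous_iff)
  also have "\<dots> = total_degree n + total_degree U"
    using mrestrict_decompose[of m A] m(2,3) total_degree_add total_degree_multideg by metis
  finally show "Poly_Mapping.keys n \<subseteq> vert -` A \<and> total_degree n = d - total_degree U"
    using m(3) by (simp add: keys_mrestrict)
qed

lemma add_eq_disjoint_keys:
  fixes a b a' b' :: "'a \<Rightarrow>\<^sub>0 nat"
  assumes "Poly_Mapping.keys a \<subseteq> A" "Poly_Mapping.keys a' \<subseteq> A"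
    "Poly_Mapping.keys b \<inter> A = {}" "Poly_Mapping.keys b' \<inter> A = {}"
  shows "a + b = a' + b' \<longleftrightarrow> a = a' \<and> b = b'"
proof
  assume eq: "a + b = a' + b'"
  have "Poly_Mapping.lookup a k = Poly_Mapping.lookup a' k" for k
  proof (cases "k \<in> A")
    case True
    then have "Poly_Mapping.lookup b k = 0" "Poly_Mapping.lookup b' k = 0"
      using assms by (auto simp: in_keys_iff)
    then show ?thesis using arg_cong[OF eq, of "\<lambda>p. Poly_Mapping.lookup p k"] by (simp add: lookup_add)
  next
    case False
    then have "Poly_Mapping.lookup a k = 0" "Poly_Mapping.lookup a' k = 0"
      using assms by (auto simp: in_keys_iff)
    then show ?thesis by simp
  qed
  then have "a = a'" by (rule poly_mapping_eqI)
  with eq show "a = a' \<and> b = b'" by simp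
qed simp

text \<open>
  A coefficient of the toric image of \<open>p\<close> survives in the toric image of the slice that belongs to
  its part outside \<open>A\<close>. This is what keeps a slice outside the prime.
\<close>

lemma lookup_toric_slice:
  assumes c: "\<And>i. c i \<in> A \<longleftrightarrow> i \<in> A"
    and keys: "Poly_Mapping.keys U1 \<subseteq> A" "Poly_Mapping.keys W1 \<subseteq> A"
      "Poly_Mapping.keys U \<inter> A = {}" "Poly_Mapping.keys W \<inter> A = {}"
    and U: "Poly_Mapping.keys U \<inter> T = {}"
  shows "Poly_Mapping.lookup (Poly_Mapping.lookup (toric T c (slice c A U W p)) U1) W1
       = Poly_Mapping.lookup (Poly_Mapping.lookup (toric T c p) (U1 + U)) (W1 + W)"
proof (induction p rule: poly_mapping_add_induct)
  case (single m a)
  let ?m1 = "mrestrict A m" and ?m2 = "mrestrict (- A) m"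
  have ydeg_in: "k \<in> A" if k: "k \<in> Poly_Mapping.keys (ydeg c ?m1)" for k
  proof -
    from k obtain j where "YV j \<in> Poly_Mapping.keys ?m1" "c j = k" by (rule keys_ydegE)
    then show ?thesis using c[of j] by (simp add: keys_mrestrict)
  qed
  have ydeg_out: "k \<notin> A" if k: "k \<in> Poly_Mapping.keys (ydeg c ?m2)" for k
  proof -
    from k obtain j where "YV j \<in> Poly_Mapping.keys ?m2" "c j = k" by (rule keys_ydegE)
    then show ?thesis using c[of j] by (simp add: keys_mrestrict)
  qed
  have "multideg m = multideg ?m1 + multideg ?m2" "ydeg c m = ydeg c ?m1 + ydeg c ?m2"
    by (metis mrestrict_decompose multideg_add, metis mrestrict_decompose ydeg_add)
  moreover have "multideg ?m1 + multideg ?m2 = U1 + U \<longleftrightarrow> multideg ?m1 = U1 \<and> multideg ?m2 = U"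
    by (rule add_eq_disjoint_keys[where A = A])
      (use keys in \<open>auto simp: keys_multideg keys_mrestrict\<close>)
  moreover have "ydeg c ?m1 + ydeg c ?m2 = W1 + W \<longleftrightarrow> ydeg c ?m1 = W1 \<and> ydeg c ?m2 = W"
    by (rule add_eq_disjoint_keys[where A = A]) (use keys ydeg_in ydeg_out in auto)
  ultimately show ?case
    using U by (auto simp: slice_single toric_single lookup_single when_def keys_add_nat)
qed (simp_all add: slice_add toric_add lookup_add)

lemma lookup_toric_nonzero:
  assumes "Poly_Mapping.lookup (Poly_Mapping.lookup (toric T c p) N) M \<noteq> 0"
  shows "\<exists>m\<in>Poly_Mapping.keys p. multideg m = N \<and> ydeg c m = M \<and> Poly_Mapping.keys N \<inter> T = {}"
proof (rule ccontr)
  assume *: "\<not> ?thesis"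
  have "Poly_Mapping.lookup (Poly_Mapping.lookup (toric T c p) N) M = 0"
  proof (induction p rule: poly_mapping_add_induct)
    case (single m a)
    then show ?case using * by (auto simp: toric_single lookup_single when_def)
  qed (simp_all add: toric_add lookup_add)
  with assms show False by simp
qed


section \<open>Additivity\<close>

lemma cluster_restrict: "cluster T E \<Longrightarrow> cluster (T \<inter> A) (E \<inter> A \<times> A)"
  unfolding cluster_def sym_def by blast

text \<open>
  The slice is linear over the polynomial ring on \<open>A\<close> and maps \<open>J {} E0\<close> to the ideal of the pairs in
  \<open>A\<close>. So for \<open>p\<close> in the restricted prime, the product of \<open>p\<close> with the slice of \<open>f\<close> is the slice of
  \<open>p * f\<close>, an element of that ideal.
\<close>

lemma witness_slice:
  assumes w: "witness V S E0 d f T E"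
    and S: "S \<subseteq> A \<times> A \<union> (- A) \<times> (- A)" and A: "A \<subseteq> V"
    and c: "class_map T E c"
    and keys: "Poly_Mapping.keys U1 \<subseteq> A" "Poly_Mapping.keys W1 \<subseteq> A"
      "Poly_Mapping.keys U \<inter> A = {}" "Poly_Mapping.keys W \<inter> A = {}"
    and U: "Poly_Mapping.keys U \<inter> T = {}"
    and nz: "Poly_Mapping.lookup (Poly_Mapping.lookup (toric T c f) (U1 + U)) (W1 + W) \<noteq> 0"
  shows "witness A (S \<inter> A \<times> A) (E0 \<inter> A \<times> A) (d - total_degree U) (slice c A U W f)
    (T \<inter> A) (E \<inter> A \<times> A)"
proof -
  note w' = w[unfolded witness_def]
  have cA: "c i \<in> A \<longleftrightarrow> i \<in> A" for i
  proof -
    have "c i = i \<or> (i, c i) \<in> S" using c w' unfolding class_map_def by blast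
    then show ?thesis using S by auto
  qed
  have "toric T c (slice c A U W f) \<noteq> 0"
    using lookup_toric_slice[OF cA keys U, of f] nz by auto
  then have "slice c A U W f \<notin> J T E" using toric_J[OF c] by blast
  then have notin: "slice c A U W f \<notin> J (T \<inter> A) (E \<inter> A \<times> A)"
    using J_mono[OF _ Int_lower1 Int_lower1] by blast
  have "slice c A U W f * p \<in> J {} (E0 \<inter> A \<times> A)"
    if p: "p \<in> pcarrier A" "p \<in> J (T \<inter> A) (E \<inter> A \<times> A)" for p
  proof -
    have "p \<in> J T E" using p(2) by (rule J_mono) auto
    then have "f * p \<in> J {} E0" using w' pcarrier_mono[OF A p(1)] by blast
    then have "slice c A U W (p * f) \<in> J {} (E0 \<inter> A \<times> A)"
      using w' S U by (intro slice_J[OF c]) (auto simp: mult.commute)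
    then show ?thesis unfolding slice_mult[OF p(1)] by (simp add: mult.commute)
  qed
  moreover have "slice c A U W f \<in> homogeneous_part (vert -` A) (d - total_degree U)"
    using w' by (blast intro: slice_homogeneous)
  moreover have "cluster (T \<inter> A) (E \<inter> A \<times> A)" using w' by (blast intro: cluster_restrict)
  moreover have "E0 \<inter> A \<times> A \<subseteq> E \<inter> A \<times> A" "E \<inter> A \<times> A \<subseteq> S \<inter> A \<times> A"
    using w' by auto
  ultimately show ?thesis
    unfolding witness_def using notin by simp
qed

text \<open>
  Choose a monomial of \<open>f\<close> whose toric image has a nonzero coefficient in that of \<open>f\<close>, and let \<open>e1\<close>
  and \<open>e2\<close> be the degrees of its parts on \<open>V1\<close> and \<open>V2\<close>, so that \<open>e1 + e2 = d\<close>. Slicing \<open>f\<close> along the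
  part on \<open>V2\<close> gives a witness of degree \<open>d - e2 = e1\<close> for \<open>V1\<close>, and the other way round. One monomial
  serves both sides, so the degrees add up to \<open>d\<close> even if \<open>f\<close> has several bidegrees.
\<close>

lemma witness_split:
  fixes f :: "('v edge_var, 'k::field) mpoly"
  assumes w: "witness (V1 \<union> V2) (S1 \<union> S2) (E1 \<union> E2) d f T E"
    and disj: "V1 \<inter> V2 = {}" and S: "S1 \<subseteq> V1 \<times> V1" "S2 \<subseteq> V2 \<times> V2"
    and E: "E1 \<subseteq> V1 \<times> V1" "E2 \<subseteq> V2 \<times> V2"
  shows "\<exists>d1 d2 (f1 :: ('v edge_var, 'k) mpoly) (f2 :: ('v edge_var, 'k) mpoly) T1 T2 E1' E2'.
    d = d1 + d2 \<and> witness V1 S1 E1 d1 f1 T1 E1' \<and> witness V2 S2 E2 d2 f2 T2 E2'"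
proof -
  note w' = w[unfolded witness_def]
  obtain c where c: "class_map T E c" using cluster_class_map w' by blast
  have "toric T c f \<noteq> 0" using w' toric_kernel[OF c] by blast
  then obtain N M where NM: "Poly_Mapping.lookup (Poly_Mapping.lookup (toric T c f) N) M \<noteq> 0"
    by (metis lookup_zero poly_mapping_eqI)
  obtain m where m: "m \<in> Poly_Mapping.keys f" "multideg m = N" "ydeg c m = M"
    and T: "Poly_Mapping.keys N \<inter> T = {}"
    using lookup_toric_nonzero[OF NM] by blast
  have keys: "Poly_Mapping.keys m \<subseteq> vert -` (V1 \<union> V2)" and d: "total_degree m = d"
    using w' m(1) unfolding homogeneous_iff by blast+
  let ?m1 = "mrestrict V1 m" and ?m2 = "mrestrict V2 m"
  have m12: "m = ?m1 + ?m2"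
    by (rule poly_mapping_eqI) (use keys disj in \<open>auto simp: lookup_add lookup_mrestrict in_keys_iff\<close>)
  have NM12: "N = multideg ?m1 + multideg ?m2" "M = ydeg c ?m1 + ydeg c ?m2"
    using m m12 multideg_add ydeg_add by metis+
  have step: "c i = i \<or> (i, c i) \<in> S1 \<union> S2" for i
    using c w' unfolding class_map_def by blast
  have cV1: "c i \<in> V1" if "i \<in> V1" for i
    using step[of i] that S disj by auto
  have cV2: "c i \<in> V2" if "i \<in> V2" for i
    using step[of i] that S disj by auto
  have u: "Poly_Mapping.keys (multideg ?m1) \<subseteq> V1" "Poly_Mapping.keys (multideg ?m2) \<subseteq> V2"
    by (auto simp: keys_multideg keys_mrestrict)
  have y: "Poly_Mapping.keys (ydeg c ?m1) \<subseteq> V1" "Poly_Mapping.keys (ydeg c ?m2) \<subseteq> V2"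
    using cV1 cV2 by (auto elim!: keys_ydegE simp: keys_mrestrict)
  have T12: "Poly_Mapping.keys (multideg ?m1) \<inter> T = {}" "Poly_Mapping.keys (multideg ?m2) \<inter> T = {}"
    using T unfolding NM12 keys_add_nat by auto
  have sets: "S1 \<union> S2 \<subseteq> V1 \<times> V1 \<union> (- V1) \<times> (- V1)" "S1 \<union> S2 \<subseteq> V2 \<times> V2 \<union> (- V2) \<times> (- V2)"
    "(S1 \<union> S2) \<inter> V1 \<times> V1 = S1" "(S1 \<union> S2) \<inter> V2 \<times> V2 = S2"
    "(E1 \<union> E2) \<inter> V1 \<times> V1 = E1" "(E1 \<union> E2) \<inter> V2 \<times> V2 = E2"
    using S E disj by blast+
  have w1: "witness V1 S1 E1 (d - total_degree (multideg ?m2))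
      (slice c V1 (multideg ?m2) (ydeg c ?m2) f) (T \<inter> V1) (E \<inter> V1 \<times> V1)"
    using witness_slice[OF w sets(1) _ c u(1) y(1) _ _ T12(2)] NM u y disj
    unfolding sets NM12 by blast
  have w2: "witness V2 S2 E2 (d - total_degree (multideg ?m1))
      (slice c V2 (multideg ?m1) (ydeg c ?m1) f) (T \<inter> V2) (E \<inter> V2 \<times> V2)"
    using witness_slice[OF w sets(2) _ c u(2) y(2) _ _ T12(1)] NM u y disj
    unfolding sets NM12 by (simp add: add.commute) blast
  have "d = total_degree ?m1 + total_degree ?m2"
    using d m12 total_degree_add by metis
  then have "d = (d - total_degree (multideg ?m2)) + (d - total_degree (multideg ?m1))"
    by (simp add: total_degree_multideg)
  with w1 w2 show ?thesis by blast
qed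

lemma cluster_union:
  assumes "cluster T1 E1" "cluster T2 E2" "E1 \<subseteq> V1 \<times> V1" "E2 \<subseteq> V2 \<times> V2" "V1 \<inter> V2 = {}"
  shows "cluster (T1 \<union> T2) (E1 \<union> E2)"
  unfolding cluster_def
proof (intro conjI allI impI)
  show "sym (E1 \<union> E2)" using assms(1,2) by (auto simp: cluster_def intro: sym_Un)
  fix i v j assume *: "(i, v) \<in> E1 \<union> E2 \<and> (v, j) \<in> E1 \<union> E2 \<and> v \<notin> T1 \<union> T2"
  then consider "(i, v) \<in> E1" "(v, j) \<in> E1" "v \<notin> T1" | "(i, v) \<in> E2" "(v, j) \<in> E2" "v \<notin> T2"
    using assms(3-5) by blast
  then show "i = j \<or> (i, j) \<in> E1 \<union> E2"
    using assms(1,2) unfolding cluster_def by cases blast+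
qed

text \<open>
  The sum of the two primes is again the ideal of a cluster graph, so it is prime. It contains
  neither \<open>f1\<close> nor \<open>f2\<close>, because retracting it to one side gives back the prime of that side.
\<close>

lemma witness_mult:
  fixes f1 f2 :: "('v::linorder edge_var, 'k::field) mpoly"
  assumes w1: "witness V1 S1 E1 d1 f1 T1 E1'" and w2: "witness V2 S2 E2 d2 f2 T2 E2'"
    and disj: "V1 \<inter> V2 = {}" and S: "S1 \<subseteq> V1 \<times> V1" "S2 \<subseteq> V2 \<times> V2"
  shows "witness (V1 \<union> V2) (S1 \<union> S2) (E1 \<union> E2) (d1 + d2) (f1 * f2) (T1 \<union> T2) (E1' \<union> E2')"
proof -
  note w1' = w1[unfolded witness_def] and w2' = w2[unfolded witness_def]
  have T: "T1 \<subseteq> V1" "T2 \<subseteq> V2" and E: "E1' \<subseteq> V1 \<times> V1" "E2' \<subseteq> V2 \<times> V2"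
    using w1' w2' S by auto
  have cl: "cluster (T1 \<union> T2) (E1' \<union> E2')"
    using cluster_union[OF _ _ E disj] w1' w2' by blast
  have sets: "(T1 \<union> T2) \<inter> V1 = T1" "(T1 \<union> T2) \<inter> V2 = T2"
    "(E1' \<union> E2') \<inter> V1 \<times> V1 = E1'" "(E1' \<union> E2') \<inter> V2 \<times> V2 = E2'"
    using T E disj by blast+
  have f1: "f1 \<in> pcarrier V1" and f2: "f2 \<in> pcarrier V2"
    using w1' w2' homogeneous_in_pcarrier by blast+
  have "f1 \<notin> J (T1 \<union> T2) (E1' \<union> E2')"
    using retract_J[of f1 "T1 \<union> T2" "E1' \<union> E2'" V1] retract_fixed[OF f1] w1' unfolding sets by auto
  moreover have "f2 \<notin> J (T1 \<union> T2) (E1' \<union> E2')"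
    using retract_J[of f2 "T1 \<union> T2" "E1' \<union> E2'" V2] retract_fixed[OF f2] w2' unfolding sets by auto
  ultimately have notin: "f1 * f2 \<notin> J (T1 \<union> T2) (E1' \<union> E2')"
    using J_cluster_prime[OF cl] by blast
  have kill: "f1 * f2 * p \<in> J {} (E1 \<union> E2)" if "p \<in> J (T1 \<union> T2) (E1' \<union> E2')" for p
    using that
  proof (induction rule: J_induct)
    case (step r g q)
    have "f1 * f2 * g \<in> J {} (E1 \<union> E2)"
    proof -
      have "g \<in> gens T1 E1' \<or> g \<in> gens T2 E2'" using step.hyps by (auto simp: gens_def)
      then show ?thesis
      proof
        assume g: "g \<in> gens T1 E1'"
        then have "g \<in> J T1 E1'" unfolding J_def by (rule gen.span_base)
        moreover have "g \<in> pcarrier V1"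
          using gens_homogeneous[OF g T(1) E(1)] homogeneous_in_pcarrier by blast
        ultimately have "f1 * g \<in> J {} E1" using w1' by blast
        then have "f1 * g \<in> J {} (E1 \<union> E2)" by (rule J_mono) auto
        from J_mult[OF this, of f2] show ?thesis by (simp add: ac_simps)
      next
        assume g: "g \<in> gens T2 E2'"
        then have "g \<in> J T2 E2'" unfolding J_def by (rule gen.span_base)
        moreover have "g \<in> pcarrier V2"
          using gens_homogeneous[OF g T(2) E(2)] homogeneous_in_pcarrier by blast
        ultimately have "f2 * g \<in> J {} E2" using w2' by blast
        then have "f2 * g \<in> J {} (E1 \<union> E2)" by (rule J_mono) auto
        from J_mult[OF this, of f1] show ?thesis by (simp add: ac_simps)
      qed
    qed
    from J_add[OF J_mult[OF this, of r] step.IH] show ?case by (simp add: algebra_simps)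
  qed simp
  have "f1 \<in> homogeneous_part (vert -` (V1 \<union> V2)) d1" "f2 \<in> homogeneous_part (vert -` (V1 \<union> V2)) d2"
    using w1' w2' unfolding homogeneous_iff by blast+
  then have "f1 * f2 \<in> homogeneous_part (vert -` (V1 \<union> V2)) (d1 + d2)" by (rule homogeneous_mult)
  then show ?thesis
    unfolding witness_def using w1' w2' cl notin kill by blast
qed

lemma Least_add:
  fixes P Q R :: "nat \<Rightarrow> bool"
  assumes "\<exists>a. P a" "\<exists>b. Q b" and R: "\<And>d. R d \<longleftrightarrow> (\<exists>a b. d = a + b \<and> P a \<and> Q b)"
  shows "(LEAST d. R d) = (LEAST a. P a) + (LEAST b. Q b)"
proof (rule Least_equality)
  show "R ((LEAST a. P a) + (LEAST b. Q b))"
    unfolding R using LeastI_ex[OF assms(1)] LeastI_ex[OF assms(2)] by blast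
  show "(LEAST a. P a) + (LEAST b. Q b) \<le> d" if "R d" for d
    using that unfolding R by (auto intro!: add_mono Least_le)
qed

theorem corollary3p12:
  fixes G G1 G2 :: "'v::linorder graph"
  assumes "finite_simple_graph G1" and "finite_simple_graph G2"
    and "verts G1 \<inter> verts G2 = {}"
    and "G = graph_union G1 G2"
  shows "v_number (edge_vars G) (binomial_edge_ideal G :: ('v edge_var, 'k::field) mpoly set)
       = v_number (edge_vars G1) (binomial_edge_ideal G1 :: ('v edge_var, 'k) mpoly set)
       + v_number (edge_vars G2) (binomial_edge_ideal G2 :: ('v edge_var, 'k) mpoly set)"
proof -
  let ?V1 = "verts G1" and ?V2 = "verts G2"
  let ?S1 = "?V1 \<times> ?V1" and ?S2 = "?V2 \<times> ?V2"
  have G: "finite_simple_graph G" "verts G = ?V1 \<union> ?V2" "arcs G = arcs G1 \<union> arcs G2"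
    using assms by (auto simp: graph_union_def finite_simple_graph_def arcs_def)
  note sub = arcs_subset[OF assms(1)] arcs_subset[OF assms(2)]
  have fin: "finite ?V1" "finite ?V2" using assms by (auto simp: finite_simple_graph_def)
  have sq: "sym (A \<times> A)" "trans (A \<times> A)" for A :: "'v set"
    by (auto simp: sym_def trans_def)
  have union: "arcs G \<subseteq> ?S1 \<union> ?S2" "?S1 \<union> ?S2 \<subseteq> verts G \<times> verts G" "sym (?S1 \<union> ?S2)" "trans (?S1 \<union> ?S2)"
    using sub assms(3) by (auto simp: G sym_def trans_def)
  let ?P = "\<lambda>V S E0 d. \<exists>(f :: ('v edge_var, 'k) mpoly) T E. witness V S E0 d f T E"
  \<comment> \<open>The decomposition of the union is carried out inside \<open>?S1 \<union> ?S2\<close>, so that no cluster meets both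
    vertex sets.\<close>
  have "(LEAST d. ?P (verts G) (?S1 \<union> ?S2) (arcs G) d)
      = (LEAST d. ?P ?V1 ?S1 (arcs G1) d) + (LEAST d. ?P ?V2 ?S2 (arcs G2) d)"
  proof (rule Least_add)
    show "\<exists>d. ?P ?V1 ?S1 (arcs G1) d"
      by (rule witness_exists[OF fin(1) subset_refl sq sym_arcs sub(1)])
    show "\<exists>d. ?P ?V2 ?S2 (arcs G2) d"
      by (rule witness_exists[OF fin(2) subset_refl sq sym_arcs sub(2)])
    show "?P (verts G) (?S1 \<union> ?S2) (arcs G) d
        \<longleftrightarrow> (\<exists>a b. d = a + b \<and> ?P ?V1 ?S1 (arcs G1) a \<and> ?P ?V2 ?S2 (arcs G2) b)" for d
    proof
      assume "?P (verts G) (?S1 \<union> ?S2) (arcs G) d"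
      then show "\<exists>a b. d = a + b \<and> ?P ?V1 ?S1 (arcs G1) a \<and> ?P ?V2 ?S2 (arcs G2) b"
        unfolding G using witness_split[OF _ assms(3) subset_refl subset_refl sub] by blast
    next
      assume "\<exists>a b. d = a + b \<and> ?P ?V1 ?S1 (arcs G1) a \<and> ?P ?V2 ?S2 (arcs G2) b"
      then show "?P (verts G) (?S1 \<union> ?S2) (arcs G) d"
        unfolding G using witness_mult[OF _ _ assms(3) subset_refl subset_refl] by blast
    qed
  qed
  then show ?thesis
    unfolding v_number_eq_Least_witness[OF G(1) union]
      v_number_eq_Least_witness[OF assms(1) sub(1) subset_refl sq]
      v_number_eq_Least_witness[OF assms(2) sub(2) subset_refl sq] .
qed

end
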